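(* Let $L>0$, $0<v<1$, $\phi^0\in H_0^1(\mathbf{I}_0)$ and $\phi^1\in L^2(\mathbf{I}_0)$, where $\mathbf{I}_t=(vt,L+vt)$. Let $\phi$ be the solution of $$\phi_{tt}-\phi_{xx}=0 \ \ (x\in\mathbf{I}_t,\ t>0),\qquad \phi(vt,t)=\phi(L+vt,t)=0\ \ (t>0),\qquad \phi(x,0)=\phi^0(x),\ \phi_t(x,0)=\phi^1(x)\ \ (x\in\mathbf{I}_0).$$ Let $x_b=0$ or $x_b=L$, and put $T_v=2L/(1-v^2)$. Then: (i) For every integer $M\ge 1$, $$\int_0^{MT_v}\phi_x^2(x_b+vt,t)\,dt=\frac{4M}{(1-v^2)^2}\,\mathcal{E}_v(0).$$ (ii) Consequently, the direct inequality $$\int_0^{T}\phi_x^2(x_b+vt,t)\,dt\le K_1(v,T)\,\mathcal{E}_v(0)\qquad\text{for every }T\ge 0$$ holds with a constant $K_1(v,T)$ depending only on $v$ and $T$ (the length $L$ being fixed). (iii) If $T\ge T_v$, the problem is observable at the endpoint $x_b+vt$, and $$\mathcal{E}_v(0)\le\frac{(1-v^2)^2}{4}\int_0^T\phi_x^2(x_b+vt,t)\,dt.$$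
   Context: Subscripts $t,x$ denote partial derivatives; all data and solutions are real valued. For $0<v<1$ and the given data, "the solution" is the (known to exist) weak solution satisfying, for every $T>0$, $\phi\in C([0,T];H_0^1(\mathbf{I}_t))$ and $\phi_t\in C([0,T];L^2(\mathbf{I}_t))$. Energy: $\mathcal{E}_v(t)=\frac12\int_{vt}^{L+vt}(\phi_t+v\phi_x)^2+(1-v^2)\phi_x^2\,dx$ for $t\ge0$; in particular $\mathcal{E}_v(0)=\frac12\int_0^L(\phi^1+v\phi^0_x)^2+(1-v^2)(\phi^0_x)^2\,dx$. Observability at the endpoint $x_b+vt$ in time $T$ means: there is a constant $C(T)>0$ such that $\mathcal{E}_v(0)\le C(T)\int_0^T\phi_x^2(x_b+vt,t)\,dt$ for all solutions of the problem. The boundary values $\phi_x(x_b+vt,t)$ are understood as the trace on the endpoint curve obtained by termwise differentiation of the series representation of the solution $$\phi(x,t)=\sum_{n\in\mathbb{Z}\setminus\{0\}}c_n\left(e^{n\pi i(1-v)(t+x)/L}-e^{n\pi i(1+v)(t-x)/L}\right),\qquad (nc_n)\in\ell^2,$$ evaluated at $x=x_b+vt$ (with convergence in $L^2_{loc}$ in $t$). *)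

theory Defs
  imports "HOL-Analysis.Analysis"
begin

text \<open>Smoothness: every iterated directional derivative exists and is Frechet differentiable
  everywhere (hence continuous). The same definition serves functions on the line and on the plane.\<close>

definition smooth :: "('a::real_normed_vector \<Rightarrow> real) \<Rightarrow> bool" where
  "smooth f \<longleftrightarrow>
     (\<forall>hs x. fold (\<lambda>h g y. frechet_derivative g (at y) h) hs f differentiable (at x))"

definition test_functions :: "'a::real_normed_vector set \<Rightarrow> ('a \<Rightarrow> real) set" where
  "test_functions U =
     {\<theta>. smooth \<theta> \<and> compact (closure {z. \<theta> z \<noteq> 0}) \<and> closure {z. \<theta> z \<noteq> 0} \<subseteq> U}"

text \<open>Elements of the spaces below are functions, not classes; every notion
  is insensitive to changes on null sets.\<close>

definition L2 :: "real \<Rightarrow> real \<Rightarrow> (real \<Rightarrow> real) set" where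
  "L2 a b = {f. f \<in> borel_measurable (lebesgue_on {a<..<b}) \<and>
                integrable (lebesgue_on {a<..<b}) (\<lambda>x. (f x)\<^sup>2)}"

definition L2_norm :: "real \<Rightarrow> real \<Rightarrow> (real \<Rightarrow> real) \<Rightarrow> real" where
  "L2_norm a b f = sqrt (\<integral>x. (f x)\<^sup>2 \<partial>lebesgue_on {a<..<b})"

definition has_weak_derivative :: "real \<Rightarrow> real \<Rightarrow> (real \<Rightarrow> real) \<Rightarrow> (real \<Rightarrow> real) \<Rightarrow> bool" where
  "has_weak_derivative a b w d \<longleftrightarrow>
     w \<in> L2 a b \<and> d \<in> L2 a b \<and>
     (\<forall>\<eta>\<in>test_functions {a<..<b}.
        (\<integral>x. w x * deriv \<eta> x \<partial>lebesgue_on {a<..<b}) =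
        - (\<integral>x. d x * \<eta> x \<partial>lebesgue_on {a<..<b}))"

text \<open>The closure of the test functions in the Sobolev space \<open>H\<^sup>1(a,b)\<close>.\<close>

definition H10 :: "real \<Rightarrow> real \<Rightarrow> (real \<Rightarrow> real) set" where
  "H10 a b = {w. \<exists>d. has_weak_derivative a b w d \<and>
     (\<exists>\<psi> :: nat \<Rightarrow> real \<Rightarrow> real.
        (\<forall>k. \<psi> k \<in> test_functions {a<..<b}) \<and>
        (\<lambda>k. L2_norm a b (\<lambda>x. \<psi> k x - w x)) \<longlonglongrightarrow> 0 \<and>
        (\<lambda>k. L2_norm a b (\<lambda>x. deriv (\<psi> k) x - d x)) \<longlonglongrightarrow> 0)}"

text \<open>Functions of space and time are written \<open>f x t\<close>. Continuity in time with values in a space of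
  functions on the moving interval \<open>(vt, L + vt)\<close> refers to the fixed interval \<open>(0, L)\<close>, via the
  translation \<open>y \<mapsto> y + vt\<close>.\<close>

definition C_L2 :: "real \<Rightarrow> real \<Rightarrow> real \<Rightarrow> (real \<Rightarrow> real \<Rightarrow> real) \<Rightarrow> bool" where
  "C_L2 L v T f \<longleftrightarrow>
     (\<forall>t\<in>{0..T}. (\<lambda>x. f x t) \<in> L2 (v * t) (L + v * t) \<and>
        ((\<lambda>s. L2_norm 0 L (\<lambda>y. f (y + v * s) s - f (y + v * t) t)) \<longlongrightarrow> 0) (at t within {0..T}))"

definition C_H10 ::
  "real \<Rightarrow> real \<Rightarrow> real \<Rightarrow> (real \<Rightarrow> real \<Rightarrow> real) \<Rightarrow> (real \<Rightarrow> real \<Rightarrow> real) \<Rightarrow> bool" where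
  "C_H10 L v T \<phi> \<phi>x \<longleftrightarrow>
     (\<forall>t\<in>{0..T}. (\<lambda>x. \<phi> x t) \<in> H10 (v * t) (L + v * t) \<and>
        has_weak_derivative (v * t) (L + v * t) (\<lambda>x. \<phi> x t) (\<lambda>x. \<phi>x x t)) \<and>
     C_L2 L v T \<phi> \<and> C_L2 L v T \<phi>x"

definition strip :: "real \<Rightarrow> real \<Rightarrow> (real \<times> real) set" where
  "strip L v = {(x, t). t > 0 \<and> v * t < x \<and> x < L + v * t}"

text \<open>The integral over the strip is iterated, so that no joint measurability is needed: for the
  integrands below the inner integral is a continuous function of \<open>t\<close> with compact support.\<close>

definition strip_integral :: "real \<Rightarrow> real \<Rightarrow> (real \<Rightarrow> real \<Rightarrow> real) \<Rightarrow> real" where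
  "strip_integral L v F =
     (\<integral>t. (\<integral>x. F x t \<partial>lebesgue_on {v * t<..<L + v * t}) \<partial>lebesgue_on {0<..})"

definition partial_x :: "(real \<times> real \<Rightarrow> real) \<Rightarrow> real \<Rightarrow> real \<Rightarrow> real" where
  "partial_x \<theta> x t = deriv (\<lambda>y. \<theta> (y, t)) x"

definition partial_t :: "(real \<times> real \<Rightarrow> real) \<Rightarrow> real \<Rightarrow> real \<Rightarrow> real" where
  "partial_t \<theta> x t = deriv (\<lambda>s. \<theta> (x, s)) t"

text \<open>\<open>\<phi>\<close> is the weak solution with data \<open>\<phi>0\<close>, \<open>\<phi>1\<close>, and \<open>\<phi>x\<close>, \<open>\<phi>t\<close> are its weak derivatives. The
  boundary conditions are contained in \<open>\<phi>(\<cdot>,t) \<in> H\<^sub>0\<^sup>1\<close>; the initial conditions make sense because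
  \<open>\<phi>\<close> and \<open>\<phi>t\<close> are continuous in time up to \<open>t = 0\<close>.\<close>

definition weak_solution ::
  "real \<Rightarrow> real \<Rightarrow> (real \<Rightarrow> real) \<Rightarrow> (real \<Rightarrow> real) \<Rightarrow>
   (real \<Rightarrow> real \<Rightarrow> real) \<Rightarrow> (real \<Rightarrow> real \<Rightarrow> real) \<Rightarrow> (real \<Rightarrow> real \<Rightarrow> real) \<Rightarrow> bool" where
  "weak_solution L v \<phi>0 \<phi>1 \<phi> \<phi>x \<phi>t \<longleftrightarrow>
     (\<forall>T>0. C_H10 L v T \<phi> \<phi>x \<and> C_L2 L v T \<phi>t) \<and>
     (\<forall>\<theta>\<in>test_functions (strip L v).
        strip_integral L v (\<lambda>x t. \<phi> x t * partial_t \<theta> x t) =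
        - strip_integral L v (\<lambda>x t. \<phi>t x t * \<theta> (x, t))) \<and>
     (\<forall>\<theta>\<in>test_functions (strip L v).
        strip_integral L v (\<lambda>x t. \<phi>t x t * partial_t \<theta> x t - \<phi>x x t * partial_x \<theta> x t) = 0) \<and>
     (AE x in lebesgue_on {0<..<L}. \<phi> x 0 = \<phi>0 x) \<and>
     (AE x in lebesgue_on {0<..<L}. \<phi>t x 0 = \<phi>1 x)"

definition energy ::
  "real \<Rightarrow> real \<Rightarrow> (real \<Rightarrow> real \<Rightarrow> real) \<Rightarrow> (real \<Rightarrow> real \<Rightarrow> real) \<Rightarrow> real \<Rightarrow> real" where
  "energy L v \<phi>x \<phi>t t =
     1 / 2 * (\<integral>x. (\<phi>t x t + v * \<phi>x x t)\<^sup>2 + (1 - v\<^sup>2) * (\<phi>x x t)\<^sup>2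
                \<partial>lebesgue_on {v * t<..<L + v * t})"

definition mode :: "real \<Rightarrow> real \<Rightarrow> int \<Rightarrow> real \<Rightarrow> real \<Rightarrow> complex" where
  "mode L v n x t =
     exp (\<i> * complex_of_real (of_int n * pi * (1 - v) * (t + x) / L)) -
     exp (\<i> * complex_of_real (of_int n * pi * (1 + v) * (t - x) / L))"

definition series_representation ::
  "real \<Rightarrow> real \<Rightarrow> (real \<Rightarrow> real \<Rightarrow> real) \<Rightarrow> (int \<Rightarrow> complex) \<Rightarrow> bool" where
  "series_representation L v \<phi> c \<longleftrightarrow>
     (\<lambda>n. (cmod (of_int n * c n))\<^sup>2) summable_on (UNIV - {0}) \<and>
     (\<forall>t\<ge>0. AE x in lebesgue_on {v * t<..<L + v * t}.
        ((\<lambda>n. c n * mode L v n x t) has_sum complex_of_real (\<phi> x t)) (UNIV - {0}))"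

text \<open>\<open>g\<close> is the boundary value \<open>t \<mapsto> \<phi>\<^sub>x(xb + vt, t)\<close>: the limit in \<open>L\<^sup>2(0,T)\<close>, for every \<open>T\<close>, of the
  series differentiated term by term in \<open>x\<close> and evaluated on the endpoint curve.\<close>

definition endpoint_trace ::
  "real \<Rightarrow> real \<Rightarrow> real \<Rightarrow> (real \<Rightarrow> real \<Rightarrow> real) \<Rightarrow> (real \<Rightarrow> real) \<Rightarrow> bool" where
  "endpoint_trace L v xb \<phi> g \<longleftrightarrow>
     (\<exists>c. series_representation L v \<phi> c \<and>
        (\<forall>T>0. g \<in> L2 0 T \<and>
           (\<lambda>N. \<integral>t. (cmod ((\<Sum>n\<in>{- int N..int N} - {0}.
                      c n * vector_derivative (\<lambda>x. mode L v n x t) (at (xb + v * t)))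
                    - complex_of_real (g t)))\<^sup>2 \<partial>lebesgue_on {0<..<T}) \<longlonglongrightarrow> 0))"

definition observable :: "real \<Rightarrow> real \<Rightarrow> real \<Rightarrow> real \<Rightarrow> bool" where
  "observable L v xb T \<longleftrightarrow>
     (\<exists>C>0. \<forall>\<phi>0\<in>H10 0 L. \<forall>\<phi>1\<in>L2 0 L. \<forall>\<phi> \<phi>x \<phi>t g.
        weak_solution L v \<phi>0 \<phi>1 \<phi> \<phi>x \<phi>t \<and> endpoint_trace L v xb \<phi> g \<longrightarrow>
        energy L v \<phi>x \<phi>t 0 \<le> C * (\<integral>t. (g t)\<^sup>2 \<partial>lebesgue_on {0..T}))"

definition T_period :: "real \<Rightarrow> real \<Rightarrow> real" where
  "T_period L v = 2 * L / (1 - v\<^sup>2)"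

end

theory Submission
  imports Defs
begin

text \<open>The wave splits into two travelling waves that both come from one function. Put
  \<open>F y = (\<Sum>n. c\<^sub>n exp (\<i> n \<pi> y / L))\<close>, a function of period \<open>2L\<close>. Then the series says
  \<open>\<phi>(x,t) = F((1 - v)(t + x)) - F((1 + v)(t - x))\<close>. Write \<open>f = F'\<close>.

  On the endpoint curve \<open>x = xb + vt\<close> the two arguments differ by 0 or by one period, so both waves
  contribute equally and \<open>\<phi>\<^sub>x(xb + vt, t) = 2 f((1 - v\<^sup>2)t + (1 - v)xb)\<close>. Over \<open>M\<close> times \<open>T\<^sub>v\<close> the
  argument of \<open>f\<close> runs through \<open>M\<close> periods, so the integral of the squared trace is
  \<open>4M/(1 - v\<^sup>2)\<close> times the integral of \<open>f\<^sup>2\<close> over a period (\<open>trace_norm_eq_profile_norm\<close>).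

  At time 0 one has \<open>\<phi>\<^sub>x = A + B\<close> and \<open>\<phi>\<^sub>t = A - B\<close> with \<open>A = (1 - v)f((1 - v)x)\<close> and
  \<open>B = (1 + v)f(-(1 + v)x)\<close>. In the energy density the product \<open>AB\<close> cancels, and what is left is
  \<open>(1 + v)A\<^sup>2 + (1 - v)B\<^sup>2\<close>. As \<open>x\<close> runs through \<open>(0,L)\<close>, the argument of \<open>f\<close> in \<open>A\<close> covers
  \<open>(0,(1 - v)L)\<close> and the one in \<open>B\<close> covers \<open>(-(1 + v)L,0)\<close>: together exactly one period. Hence the
  energy is \<open>1 - v\<^sup>2\<close> times the integral of \<open>f\<^sup>2\<close> over a period (\<open>energy_eq_profile_norm\<close>), and
  comparing the two integrals gives the identity for \<open>M T\<^sub>v\<close> (\<open>trace_energy_identity\<close>). The two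
  inequalities follow because the squared trace has a nonnegative integrand.

  The analytic work is to make the decomposition at time 0 rigorous. The profile \<open>f\<close> is only a limit
  in \<open>L\<^sup>2\<close> of the differentiated partial sums; it is read off from the given trace, which determines it
  on every bounded interval (\<open>endpoint_trace_imp_profile\<close>). The functions \<open>\<phi>\<^sub>x(\<cdot>,0)\<close> and
  \<open>\<phi>\<^sub>t(\<cdot>,0)\<close> are known only through integrals against test functions. For \<open>\<phi>\<^sub>x\<close> it suffices that a
  weak derivative is determined by smooth approximations (\<open>weak_derivative_of_limit\<close>). For \<open>\<phi>\<^sub>t\<close>, the
  weak equation tested with products \<open>\<eta>(x)\<rho>(t)\<close> yields the same statement for the function
  \<open>t \<mapsto> \<integral> \<phi>(x,t) \<eta>(x) dx\<close> on a short interval \<open>(0,\<delta>)\<close>, and continuity in time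
  carries it to \<open>t = 0\<close> (\<open>time_derivative_at_0_of_limit\<close>). Both rest on the fundamental lemma of the
  calculus of variations for an explicit family of bump functions.\<close>

section \<open>Explicit bump functions\<close>

text \<open>The factor \<open>p(1/x)\<close> makes the family closed under differentiation: the derivative of
  \<open>p(1/x) exp(-1/x)\<close> is again of this form.\<close>
definition flat :: "real poly \<Rightarrow> real \<Rightarrow> real" where
  "flat p x = (if x \<le> 0 then 0 else poly p (1 / x) * exp (- 1 / x))"

lemma poly_times_exp_tendsto_0:
  fixes p :: "real poly"
  shows "((\<lambda>y. poly p y * exp (- y)) \<longlongrightarrow> 0) at_top"
proof -
  have "((\<lambda>y. \<Sum>i\<le>degree p. coeff p i * (y ^ i / exp y)) \<longlongrightarrow> (\<Sum>i\<le>degree p. coeff p i * 0)) at_top"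
    by (intro tendsto_sum tendsto_mult tendsto_const tendsto_power_div_exp_0)
  then show ?thesis
    by (simp add: poly_altdef sum_distrib_right exp_minus divide_inverse mult.assoc)
qed

lemma flat_has_derivative:
  "(flat p has_real_derivative flat ([:0, 0, 1:] * (p - pderiv p)) x) (at x)"
proof -
  consider "x < 0" | "x = 0" | "x > 0" by linarith
  then show ?thesis
  proof cases
    case 1
    have "(flat p has_real_derivative 0) (at x)"
      by (rule has_field_derivative_transform_within_open[where f="\<lambda>_. 0" and S="{..<0}"])
        (use 1 in \<open>auto simp: flat_def\<close>)
    then show ?thesis using 1 by (simp add: flat_def)
  next
    case 2
    have "((\<lambda>y. poly (pCons 0 p) y * exp (- y)) \<longlongrightarrow> 0) at_top"
      by (rule poly_times_exp_tendsto_0)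
    from filterlim_compose[OF this filterlim_inverse_at_top_right]
    have "((\<lambda>h. poly (pCons 0 p) (inverse h) * exp (- inverse h)) \<longlongrightarrow> 0) (at_right 0)" .
    then have "((\<lambda>h. flat p h / h) \<longlongrightarrow> 0) (at_right 0)"
      by (rule Lim_transform_eventually)
        (auto simp: eventually_at_right_field flat_def field_simps intro!: exI[of _ 1])
    moreover have "((\<lambda>h. flat p h / h) \<longlongrightarrow> 0) (at_left 0)"
      by (rule Lim_transform_eventually[OF tendsto_const])
        (auto simp: eventually_at_left_field flat_def intro!: exI[of _ "-1"])
    ultimately have "((\<lambda>h. flat p h / h) \<longlongrightarrow> 0) (at 0)"
      by (simp add: filterlim_split_at)
    then show ?thesis
      unfolding 2 by (simp add: has_field_derivative_iff flat_def)
  next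
    case 3
    have "((\<lambda>x. poly p (1 / x) * exp (- 1 / x)) has_real_derivative
            flat ([:0, 0, 1:] * (p - pderiv p)) x) (at x)"
      using 3 by (auto intro!: derivative_eq_intros DERIV_chain2[OF poly_DERIV]
          simp: flat_def field_simps power2_eq_square)
    then show ?thesis
      by (rule has_field_derivative_transform_within_open[where S="{0<..}"])
        (use 3 in \<open>auto simp: flat_def\<close>)
  qed
qed

text \<open>Smoothness is proved by exhibiting a class of functions closed under directional derivatives.
  It is stated over a normed space so that it yields test functions on the line and on the plane.\<close>
inductive flat_algebra :: "('a::real_normed_vector \<Rightarrow> real) \<Rightarrow> bool" where
  flat: "bounded_linear l \<Longrightarrow> flat_algebra (\<lambda>x. flat p (l x + b))"
| const: "flat_algebra (\<lambda>x. c)"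
| add: "flat_algebra f \<Longrightarrow> flat_algebra g \<Longrightarrow> flat_algebra (\<lambda>x. f x + g x)"
| mult: "flat_algebra f \<Longrightarrow> flat_algebra g \<Longrightarrow> flat_algebra (\<lambda>x. f x * g x)"

lemma flat_algebra_derivative:
  assumes "flat_algebra f"
  shows "\<exists>f'. (\<forall>x. (f has_derivative f' x) (at x)) \<and> (\<forall>h. flat_algebra (\<lambda>x. f' x h))"
  using assms
proof induction
  case (flat l p b)
  have "((\<lambda>x. flat p (l x + b)) has_derivative
      (\<lambda>h. flat ([:0, 0, 1:] * (p - pderiv p)) (l x + b) * l h)) (at x)" for x
  proof -
    have "((\<lambda>x. l x + b) has_derivative l) (at x)"
      using bounded_linear_imp_has_derivative[OF flat] by (auto intro!: derivative_eq_intros)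
    from has_derivative_compose[OF this flat_has_derivative[THEN has_field_derivative_imp_has_derivative]]
    show ?thesis by simp
  qed
  then show ?case
    by (intro exI[of _ "\<lambda>x h. flat ([:0, 0, 1:] * (p - pderiv p)) (l x + b) * l h"])
      (auto simp del: mult_pCons_left intro: flat_algebra.mult[OF flat_algebra.flat[OF flat] flat_algebra.const])
next
  case (const c)
  show ?case by (rule exI[of _ "\<lambda>_ _. 0"]) (auto intro: flat_algebra.intros)
next
  case (add f g)
  then obtain f' g' where "\<forall>x. (f has_derivative f' x) (at x)" "\<forall>h. flat_algebra (\<lambda>x. f' x h)"
    "\<forall>x. (g has_derivative g' x) (at x)" "\<forall>h. flat_algebra (\<lambda>x. g' x h)" by blast
  then show ?case
    by (intro exI[of _ "\<lambda>x h. f' x h + g' x h"])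
      (auto intro: flat_algebra.intros has_derivative_add)
next
  case (mult f g)
  then obtain f' g' where "\<forall>x. (f has_derivative f' x) (at x)" "\<forall>h. flat_algebra (\<lambda>x. f' x h)"
    "\<forall>x. (g has_derivative g' x) (at x)" "\<forall>h. flat_algebra (\<lambda>x. g' x h)" by blast
  then show ?case using mult.hyps
    by (intro exI[of _ "\<lambda>x h. f x * g' x h + f' x h * g x"])
      (auto intro!: flat_algebra.intros(3,4) has_derivative_mult)
qed

lemma flat_algebra_smooth:
  assumes "flat_algebra f"
  shows "smooth f"
  unfolding smooth_def
proof (intro allI)
  fix hs x
  show "fold (\<lambda>h g y. frechet_derivative g (at y) h) hs f differentiable at x"
    using assms
  proof (induction hs arbitrary: f)
    case Nil
    then show ?case using flat_algebra_derivative[OF Nil] by (auto simp: differentiable_def)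
  next
    case (Cons h hs)
    obtain f' where f': "\<forall>x. (f has_derivative f' x) (at x)" "flat_algebra (\<lambda>x. f' x h)"
      using flat_algebra_derivative[OF Cons.prems] by blast
    then have "(\<lambda>y. frechet_derivative f (at y) h) = (\<lambda>x. f' x h)"
      by (metis frechet_derivative_at)
    then show ?case using Cons.IH[OF f'(2)] by simp
  qed
qed

text \<open>The parameter \<open>k\<close> steepens the flanks: the bumps tend pointwise to the indicator of \<open>(c,d)\<close>
  while staying between 0 and 1, which is what dominated convergence needs.\<close>
definition bump :: "nat \<Rightarrow> real \<Rightarrow> real \<Rightarrow> real \<Rightarrow> real" where
  "bump k c d x = flat 1 (real k * (x - c)) * flat 1 (real k * (d - x))"

lemma bump_algebra:
  assumes "bounded_linear l"
  shows "flat_algebra (\<lambda>x. bump k c d (l x))"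
proof -
  have "bounded_linear (\<lambda>x. real k * l x)" "bounded_linear (\<lambda>x. - real k * l x)"
    by (intro bounded_linear_const_mult assms)+
  from flat_algebra.mult[OF flat_algebra.flat[OF this(1)] flat_algebra.flat[OF this(2)],
      of 1 "- real k * c" 1 "real k * d"]
  show ?thesis by (simp add: bump_def algebra_simps)
qed

lemma bump_nonneg: "0 \<le> bump k c d x"
  by (simp add: bump_def flat_def)

lemma bump_le_1: "bump k c d x \<le> 1"
  by (auto simp: bump_def flat_def mult_le_one)

lemma bump_eq_0: "x \<notin> {c<..<d} \<Longrightarrow> bump k c d x = 0"
  by (auto simp: bump_def flat_def mult_le_0_iff)

lemma bump_nonzeroD: "bump k c d x \<noteq> 0 \<Longrightarrow> c < x \<and> x < d"
  using bump_eq_0 by (metis greaterThanLessThan_iff)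

lemma bump_tendsto_indicator: "(\<lambda>k. bump k c d x) \<longlonglongrightarrow> indicator {c<..<d} x"
proof (cases "x \<in> {c<..<d}")
  case True
  have *: "(\<lambda>k. flat 1 (real k * a)) \<longlonglongrightarrow> 1" if "a > 0" for a
  proof -
    have "(\<lambda>k. exp (- 1 / a * inverse (real k))) \<longlonglongrightarrow> exp (- 1 / a * 0)"
      by (intro tendsto_intros lim_inverse_n)
    then have "(\<lambda>k. exp (- 1 / a * inverse (real k))) \<longlonglongrightarrow> 1" by simp
    then show ?thesis
      by (rule Lim_transform_eventually)
        (use that in \<open>auto intro!: eventually_sequentiallyI[of 1] simp: flat_def field_simps mult_le_0_iff\<close>)
  qed
  have "(\<lambda>k. bump k c d x) \<longlonglongrightarrow> 1 * 1"
    unfolding bump_def by (intro tendsto_mult *) (use True in auto)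
  then show ?thesis using True by simp
next
  case False
  then show ?thesis by (simp add: bump_eq_0)
qed

lemma bump_deriv_exists:
  "\<exists>b'. (\<forall>x. (bump k c d has_real_derivative b' x) (at x)) \<and> continuous_on UNIV b'"
proof -
  obtain f' where f': "\<And>x. ((\<lambda>x. bump k c d x) has_derivative f' x) (at x)"
      and alg: "flat_algebra (\<lambda>x. f' x 1)"
    using flat_algebra_derivative[OF bump_algebra[of "\<lambda>x. x", OF bounded_linear_ident]] by blast
  have "(bump k c d has_real_derivative f' x 1) (at x)" for x
  proof -
    have "f' x h = f' x 1 * h" for h
      using linear_simps(5)[OF has_derivative_bounded_linear[OF f'[of x]], of h 1] by simp
    then have "f' x = (*) (f' x 1)" by (rule ext)
    then show ?thesis using f'[of x] unfolding has_field_derivative_def by simp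
  qed
  moreover have "continuous_on UNIV (\<lambda>x. f' x 1)"
    using flat_algebra_derivative[OF alg]
    by (meson continuous_at_imp_continuous_on has_derivative_continuous)
  ultimately show ?thesis by (intro exI[of _ "\<lambda>x. f' x 1"]) auto
qed

lemma bump_has_deriv: "(bump k c d has_real_derivative deriv (bump k c d) x) (at x)"
  using bump_deriv_exists[of k c d] by (metis DERIV_imp_deriv)

lemma continuous_on_deriv_bump: "continuous_on S (deriv (bump k c d))"
proof -
  obtain b' where "\<And>x. (bump k c d has_real_derivative b' x) (at x)" "continuous_on UNIV b'"
    using bump_deriv_exists[of k c d] by blast
  then have "deriv (bump k c d) = b'" by (metis DERIV_imp_deriv ext)
  then show ?thesis using \<open>continuous_on UNIV b'\<close> continuous_on_subset by blast
qed

lemma continuous_on_bump: "continuous_on S (bump k c d)"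
  by (meson DERIV_isCont bump_has_deriv continuous_at_imp_continuous_on)

lemma deriv_bump_eq_0:
  assumes "x \<notin> {c..d}" shows "deriv (bump k c d) x = 0"
proof -
  have "(bump k c d has_real_derivative 0) (at x)"
    by (rule has_field_derivative_transform_within_open[where f="\<lambda>_. 0" and S="- {c..d}"])
      (use assms in \<open>auto simp: bump_eq_0\<close>)
  then show ?thesis by (rule DERIV_imp_deriv)
qed

lemma bump_test_function:
  assumes "a < c" "d < b"
  shows "bump k c d \<in> test_functions {a<..<b}"
proof -
  have "{x. bump k c d x \<noteq> 0} \<subseteq> {c..d}" using bump_nonzeroD by (auto simp: less_imp_le)
  then have cl: "closure {x. bump k c d x \<noteq> 0} \<subseteq> {c..d}" by (rule closure_minimal) auto
  then have "compact (closure {x. bump k c d x \<noteq> 0})"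
    by (meson bounded_subset bounded_closed_interval closed_closure compact_eq_bounded_closed)
  moreover have "smooth (bump k c d)"
    using flat_algebra_smooth[OF bump_algebra[of "\<lambda>x. x", OF bounded_linear_ident]] by simp
  ultimately show ?thesis using cl assms by (auto simp: test_functions_def)
qed

text \<open>The left end of the strip moves to the right with speed \<open>v\<close>, so a spatial support to the right
  of \<open>v e\<close> is inside all time slices up to time \<open>e\<close>.\<close>
lemma bump_product_test_function:
  assumes "0 < v" "0 < s" "v * e < c" "d < L"
  shows "(\<lambda>z. bump k c d (fst z) * bump j s e (snd z)) \<in> test_functions (strip L v)"
proof -
  let ?\<theta> = "\<lambda>z. bump k c d (fst z) * bump j s e (snd z)"
  have "{z. ?\<theta> z \<noteq> 0} \<subseteq> {c..d} \<times> {s..e}" using bump_nonzeroD by (auto simp: less_imp_le)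
  then have cl: "closure {z. ?\<theta> z \<noteq> 0} \<subseteq> {c..d} \<times> {s..e}"
    by (rule closure_minimal) (auto intro: closed_Times)
  then have "compact (closure {z. ?\<theta> z \<noteq> 0})"
    using bounded_subset[OF compact_imp_bounded[OF compact_Times[OF compact_Icc compact_Icc]] cl]
    by (simp add: compact_eq_bounded_closed)
  moreover have "smooth ?\<theta>"
    by (intro flat_algebra_smooth flat_algebra.mult bump_algebra bounded_linear_fst bounded_linear_snd)
  moreover have "{c..d} \<times> {s..e} \<subseteq> strip L v"
  proof -
    have "v * t < x \<and> x < L + v * t" if "c \<le> x" "x \<le> d" "s \<le> t" "t \<le> e" for x t
    proof -
      have "v * t \<le> v * e" "0 < v * t" using that assms by auto
      then show ?thesis using that assms by linarith
    qed
    then show ?thesis using assms by (auto simp: strip_def)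
  qed
  ultimately show ?thesis using cl by (auto simp: test_functions_def)
qed

section \<open>Lebesgue integrals over intervals\<close>

lemma square_integrable_mult:
  fixes f g :: "'a \<Rightarrow> real"
  assumes [measurable]: "f \<in> borel_measurable M" "g \<in> borel_measurable M"
    and "integrable M (\<lambda>x. (f x)\<^sup>2)" "integrable M (\<lambda>x. (g x)\<^sup>2)"
  shows "integrable M (\<lambda>x. f x * g x)"
proof (rule Bochner_Integration.integrable_bound)
  show "integrable M (\<lambda>x. (f x)\<^sup>2 + (g x)\<^sup>2)" using assms by simp
  have "\<bar>a * b\<bar> \<le> a\<^sup>2 + b\<^sup>2" for a b :: real
  proof -
    have "0 \<le> (\<bar>a\<bar> - \<bar>b\<bar>)\<^sup>2" "0 \<le> \<bar>a\<bar> * \<bar>b\<bar>" by simp_all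
    then show ?thesis unfolding power2_diff abs_mult power2_abs by linarith
  qed
  then show "AE x in M. norm (f x * g x) \<le> norm ((f x)\<^sup>2 + (g x)\<^sup>2)"
    by simp
qed measurable

text \<open>The quadratic polynomial \<open>t \<mapsto> \<integral>(t f + g)\<^sup>2\<close> is nonnegative; evaluating it at its
  minimum gives the inequality.\<close>
lemma Cauchy_Schwarz_integral:
  fixes f g :: "'a \<Rightarrow> real"
  assumes m: "f \<in> borel_measurable M" "g \<in> borel_measurable M"
    and i: "integrable M (\<lambda>x. (f x)\<^sup>2)" "integrable M (\<lambda>x. (g x)\<^sup>2)"
  shows "(\<integral>x. f x * g x \<partial>M)\<^sup>2 \<le> (\<integral>x. (f x)\<^sup>2 \<partial>M) * (\<integral>x. (g x)\<^sup>2 \<partial>M)"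
proof -
  define A B C where "A = (\<integral>x. (f x)\<^sup>2 \<partial>M)" and "B = (\<integral>x. (g x)\<^sup>2 \<partial>M)"
    and "C = (\<integral>x. f x * g x \<partial>M)"
  note fg = square_integrable_mult[OF m i]
  have q: "0 \<le> t\<^sup>2 * A + 2 * t * C + B" for t
  proof -
    have "0 \<le> (\<integral>x. (t * f x + g x)\<^sup>2 \<partial>M)" by (rule integral_nonneg_AE) simp
    also have "\<dots> = (\<integral>x. t\<^sup>2 * (f x)\<^sup>2 + 2 * t * (f x * g x) + (g x)\<^sup>2 \<partial>M)"
      by (simp add: power2_sum power_mult_distrib algebra_simps)
    also have "\<dots> = t\<^sup>2 * A + 2 * t * C + B"
      unfolding A_def B_def C_def using i fg by simp
    finally show ?thesis .
  qed
  have "A \<ge> 0" unfolding A_def by (rule integral_nonneg_AE) simp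
  have "C\<^sup>2 \<le> A * B"
  proof (cases "A = 0")
    case True
    have "C = 0"
    proof (rule ccontr)
      assume "C \<noteq> 0"
      \<comment> \<open>Here the polynomial is \<open>2tC + B\<close>, which takes the value \<open>-1\<close> at this point.\<close>
      with q[of "- (B + 1) / (2 * C)"] True show False by (simp add: field_simps)
    qed
    then show ?thesis using True by simp
  next
    case False
    with \<open>A \<ge> 0\<close> have "A > 0" by simp
    from q[of "- C / A"] have "0 \<le> A * ((- C / A)\<^sup>2 * A + 2 * (- C / A) * C + B)"
      using \<open>A \<ge> 0\<close> by (rule mult_nonneg_nonneg[rotated])
    also have "\<dots> = A * B - C\<^sup>2" using \<open>A > 0\<close> by (simp add: field_simps power2_eq_square)
    finally show ?thesis by simp
  qed
  then show ?thesis by (simp add: A_def B_def C_def)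
qed

lemma integrable_lebesgue_on_Ioo_iff:
  fixes f :: "real \<Rightarrow> real"
  shows "integrable (lebesgue_on {a<..<b}) f \<longleftrightarrow> integrable (lebesgue_on {a..b}) f"
  using absolutely_integrable_on_Icc_iff_Ioo[where f=f and a=a and b=b]
  by (simp add: set_integrable_def integrable_restrict_space)

lemma integral_lebesgue_on_Ioo:
  fixes f :: "real \<Rightarrow> real"
  shows "integral\<^sup>L (lebesgue_on {a<..<b}) f = integral\<^sup>L (lebesgue_on {a..b}) f"
proof (cases "integrable (lebesgue_on {a..b}) f")
  case True
  then show ?thesis
    using True[folded integrable_lebesgue_on_Ioo_iff]
    by (simp add: lebesgue_integral_eq_integral integral_open_interval_real)
next
  case False
  then show ?thesis
    using False[folded integrable_lebesgue_on_Ioo_iff] by (simp add: not_integrable_integral_eq)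
qed

text \<open>The set \<open>S\<close> is the preimage of \<open>S'\<close>; giving it as a hypothesis instead of a formula covers
  increasing and decreasing substitutions at once.\<close>
lemma lebesgue_on_affine:
  fixes f :: "real \<Rightarrow> real"
  assumes c: "c \<noteq> 0" and S: "S \<in> sets lebesgue" "S' \<in> sets lebesgue"
    and eq: "\<And>x. t + c * x \<in> S' \<longleftrightarrow> x \<in> S"
  shows "integrable (lebesgue_on S) (\<lambda>x. f (t + c * x)) \<longleftrightarrow> integrable (lebesgue_on S') f"
    and "(\<integral>x. f (t + c * x) \<partial>lebesgue_on S) = (\<integral>x. f x \<partial>lebesgue_on S') / \<bar>c\<bar>"
    and "f \<in> borel_measurable (lebesgue_on S') \<Longrightarrow> (\<lambda>x. f (t + c * x)) \<in> borel_measurable (lebesgue_on S)"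
proof -
  have ind: "indicator S' (t + c * x) = (indicator S x :: real)" for x
    using eq[of x] by (auto simp: indicator_def)
  show "integrable (lebesgue_on S) (\<lambda>x. f (t + c * x)) \<longleftrightarrow> integrable (lebesgue_on S') f"
    using lebesgue_integrable_real_affine_iff[OF c, of "\<lambda>x. indicator S' x *\<^sub>R f x" t] S
    by (simp add: integrable_restrict_space ind)
  show "(\<integral>x. f (t + c * x) \<partial>lebesgue_on S) = (\<integral>x. f x \<partial>lebesgue_on S') / \<bar>c\<bar>"
    using lebesgue_integral_real_affine[OF c, of "\<lambda>x. indicator S' x *\<^sub>R f x" t] S c
    by (simp add: integral_restrict_space ind)
  show "(\<lambda>x. f (t + c * x)) \<in> borel_measurable (lebesgue_on S)"
    if "f \<in> borel_measurable (lebesgue_on S')"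
  proof -
    have "(\<lambda>x. indicator S' x *\<^sub>R f x) \<in> borel_measurable lebesgue"
      using that S by (subst (asm) borel_measurable_restrict_space_iff) auto
    from borel_measurable_affine[OF this c, of t]
    have "(\<lambda>x. indicator S x *\<^sub>R f (t + c * x)) \<in> borel_measurable lebesgue"
      by (simp add: ind)
    then show ?thesis using S by (subst borel_measurable_restrict_space_iff) auto
  qed
qed


lemma integrable_lebesgue_on_subset:
  fixes f :: "real \<Rightarrow> real"
  assumes "integrable (lebesgue_on T) f" "S \<subseteq> T" "S \<in> sets lebesgue" "T \<in> sets lebesgue"
  shows "integrable (lebesgue_on S) f"
proof -
  have "integrable lebesgue (\<lambda>x. indicator T x *\<^sub>R f x)"
    using assms by (simp add: integrable_restrict_space)
  from integrable_mult_indicator[OF assms(3) this]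
  have "integrable lebesgue (\<lambda>x. indicator S x *\<^sub>R f x)"
    by (rule back_subst[of "integrable lebesgue"]) (use assms(2) in \<open>auto simp: indicator_def intro!: ext\<close>)
  then show ?thesis using assms by (simp add: integrable_restrict_space)
qed

lemma integral_lebesgue_on_subset_mono:
  fixes f :: "real \<Rightarrow> real"
  assumes "integrable (lebesgue_on T) f" "S \<subseteq> T" "S \<in> sets lebesgue" "T \<in> sets lebesgue"
    and "\<And>x. x \<in> T \<Longrightarrow> 0 \<le> f x"
  shows "integral\<^sup>L (lebesgue_on S) f \<le> integral\<^sup>L (lebesgue_on T) f"
proof -
  note S = integrable_lebesgue_on_subset[OF assms(1-4)]
  have "integral\<^sup>L lebesgue (\<lambda>x. indicator S x *\<^sub>R f x) \<le> integral\<^sup>L lebesgue (\<lambda>x. indicator T x *\<^sub>R f x)"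
    using S assms by (intro integral_mono) (auto simp: integrable_restrict_space indicator_def)
  then show ?thesis using assms by (simp add: integral_restrict_space)
qed

lemma integral_lebesgue_on_support:
  fixes f :: "real \<Rightarrow> real"
  assumes "S \<subseteq> T" "S \<in> sets lebesgue" "T \<in> sets lebesgue" "\<And>x. x \<in> T - S \<Longrightarrow> f x = 0"
  shows "integral\<^sup>L (lebesgue_on T) f = integral\<^sup>L (lebesgue_on S) f"
proof -
  have "integral\<^sup>L lebesgue (\<lambda>x. indicator S x *\<^sub>R f x) = integral\<^sup>L lebesgue (\<lambda>x. indicator T x *\<^sub>R f x)"
    using assms by (intro Bochner_Integration.integral_cong) (auto simp: indicator_def)
  then show ?thesis using assms by (simp add: integral_restrict_space)
qed

lemma continuous_integrable_Ioo:
  fixes f :: "real \<Rightarrow> real"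
  assumes "continuous_on {a..b} f"
  shows "integrable (lebesgue_on {a<..<b}) f"
  using continuous_imp_integrable_real[OF assms] by (simp add: integrable_lebesgue_on_Ioo_iff)

lemma continuous_integral_Ioo:
  fixes f :: "real \<Rightarrow> real"
  assumes "continuous_on {a..b} f"
  shows "integral\<^sup>L (lebesgue_on {a<..<b}) f = integral {a..b} f"
  using continuous_imp_integrable_real[OF assms]
  by (simp add: integral_lebesgue_on_Ioo lebesgue_integral_eq_integral)

section \<open>Square-integrable functions on an interval\<close>

lemma L2_measurable: "f \<in> L2 a b \<Longrightarrow> f \<in> borel_measurable (lebesgue_on {a<..<b})"
  and L2_integrable_square: "f \<in> L2 a b \<Longrightarrow> integrable (lebesgue_on {a<..<b}) (\<lambda>x. (f x)\<^sup>2)"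
  by (auto simp: L2_def)

lemma L2_integrable_mult:
  "f \<in> L2 a b \<Longrightarrow> g \<in> L2 a b \<Longrightarrow> integrable (lebesgue_on {a<..<b}) (\<lambda>x. f x * g x)"
  by (auto simp: L2_def intro: square_integrable_mult)

lemma continuous_L2:
  assumes "continuous_on {a..b} f"
  shows "f \<in> L2 a b"
  using assms continuous_integrable_Ioo[OF assms]
    continuous_integrable_Ioo[OF continuous_on_power[OF assms, of 2]]
  by (auto simp: L2_def)

lemma L2_integrable: "f \<in> L2 a b \<Longrightarrow> integrable (lebesgue_on {a<..<b}) f"
  using L2_integrable_mult[of f a b "\<lambda>_. 1"] continuous_L2[of a b "\<lambda>_. 1"] by simp

lemma L2_add: "f \<in> L2 a b \<Longrightarrow> g \<in> L2 a b \<Longrightarrow> (\<lambda>x. f x + g x) \<in> L2 a b"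
  using L2_integrable_mult[of f a b g] by (auto simp: L2_def power2_sum mult.assoc)

lemma L2_cmult: "f \<in> L2 a b \<Longrightarrow> (\<lambda>x. c * f x) \<in> L2 a b"
  by (auto simp: L2_def power_mult_distrib)

lemma L2_diff: "f \<in> L2 a b \<Longrightarrow> g \<in> L2 a b \<Longrightarrow> (\<lambda>x. f x - g x) \<in> L2 a b"
  using L2_add[of f a b "\<lambda>x. - 1 * g x"] L2_cmult[of g a b "-1"] by simp

lemma L2_subset:
  assumes "f \<in> L2 a b" "{c<..<d} \<subseteq> {a<..<b}"
  shows "f \<in> L2 c d"
proof -
  have "f \<in> borel_measurable (lebesgue_on {c<..<d})"
    by (rule measurable_restrict_mono[OF L2_measurable[OF assms(1)] assms(2)])
  then show ?thesis
    using integrable_lebesgue_on_subset[OF L2_integrable_square[OF assms(1)] assms(2)]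
    by (auto simp: L2_def)
qed

lemma L2_norm_nonneg [simp]: "0 \<le> L2_norm a b f"
  by (simp add: L2_norm_def)

lemma L2_norm_square: "(L2_norm a b f)\<^sup>2 = (\<integral>x. (f x)\<^sup>2 \<partial>lebesgue_on {a<..<b})"
  by (simp add: L2_norm_def integral_nonneg_AE)

lemma L2_norm_subset_mono:
  assumes "f \<in> L2 a b" "{c<..<d} \<subseteq> {a<..<b}"
  shows "L2_norm c d f \<le> L2_norm a b f"
  unfolding L2_norm_def
  by (intro real_sqrt_le_mono integral_lebesgue_on_subset_mono L2_integrable_square assms) auto

lemma L2_norm_minus_commute: "L2_norm a b (\<lambda>x. f x - g x) = L2_norm a b (\<lambda>x. g x - f x)"
  by (simp add: L2_norm_def power2_commute)

lemma L2_norm_cmult: "L2_norm a b (\<lambda>x. c * f x) = \<bar>c\<bar> * L2_norm a b f"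
  by (simp add: L2_norm_def power_mult_distrib real_sqrt_mult)

lemma L2_Cauchy_Schwarz:
  assumes "f \<in> L2 a b" "g \<in> L2 a b"
  shows "\<bar>\<integral>x. f x * g x \<partial>lebesgue_on {a<..<b}\<bar> \<le> L2_norm a b f * L2_norm a b g"
proof -
  have "(\<integral>x. f x * g x \<partial>lebesgue_on {a<..<b})\<^sup>2 \<le> (L2_norm a b f * L2_norm a b g)\<^sup>2"
    using Cauchy_Schwarz_integral[of f "lebesgue_on {a<..<b}" g] assms
    by (simp add: L2_def power_mult_distrib L2_norm_square)
  then show ?thesis by (rule abs_le_square_iff[THEN iffD2, THEN order_trans]) simp
qed

lemma L2_norm_triangle:
  assumes "f \<in> L2 a b" "g \<in> L2 a b"
  shows "L2_norm a b (\<lambda>x. f x + g x) \<le> L2_norm a b f + L2_norm a b g"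
proof -
  have "(L2_norm a b (\<lambda>x. f x + g x))\<^sup>2 =
      (L2_norm a b f)\<^sup>2 + (L2_norm a b g)\<^sup>2 + 2 * (\<integral>x. f x * g x \<partial>lebesgue_on {a<..<b})"
    unfolding L2_norm_square power2_sum
    using assms L2_integrable_mult[OF assms] by (simp add: L2_integrable_square mult.assoc)
  also have "\<dots> \<le> (L2_norm a b f + L2_norm a b g)\<^sup>2"
    using L2_Cauchy_Schwarz[OF assms] by (simp add: power2_sum)
  finally show ?thesis by (rule power2_le_imp_le) simp
qed

lemma L2_norm_const_1: "a \<le> b \<Longrightarrow> L2_norm a b (\<lambda>_. 1) = sqrt (b - a)"
  by (simp add: L2_norm_def measure_restrict_space)

lemma L2_norm_bounded:
  assumes "a \<le> b" "f \<in> borel_measurable (lebesgue_on {a<..<b})" 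
    and "AE x in lebesgue_on {a<..<b}. \<bar>f x\<bar> \<le> B" "0 \<le> B"
  shows "f \<in> L2 a b" "L2_norm a b f \<le> B * sqrt (b - a)"
proof -
  have const: "integrable (lebesgue_on {a<..<b}) (\<lambda>_. B\<^sup>2)" 
    by (rule continuous_integrable_Ioo) simp
  have ae: "AE x in lebesgue_on {a<..<b}. (f x)\<^sup>2 \<le> B\<^sup>2"
    using assms(3) by eventually_elim (use assms(4) in \<open>simp add: abs_le_square_iff[symmetric]\<close>)
  have int: "integrable (lebesgue_on {a<..<b}) (\<lambda>x. (f x)\<^sup>2)"
    by (rule Bochner_Integration.integrable_bound[OF const]) (use assms(2) ae in auto)
  then show "f \<in> L2 a b" using assms(2) by (simp add: L2_def)
  have "L2_norm a b f \<le> sqrt (\<integral>x. B\<^sup>2 \<partial>lebesgue_on {a<..<b})"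
    unfolding L2_norm_def by (intro real_sqrt_le_mono integral_mono_AE int const ae)
  also have "\<dots> = B * sqrt (b - a)"
    using assms by (simp add: measure_restrict_space real_sqrt_mult)
  finally show "L2_norm a b f \<le> B * sqrt (b - a)" .
qed

lemma L2_affine:
  assumes f: "f \<in> L2 p q" and c: "c \<noteq> 0"
    and sub: "\<And>x. x \<in> {a<..<b} \<Longrightarrow> t + c * x \<in> {p<..<q}"
  shows "(\<lambda>x. f (t + c * x)) \<in> L2 a b"
    and "L2_norm a b (\<lambda>x. f (t + c * x)) \<le> L2_norm p q f / sqrt \<bar>c\<bar>"
proof -
  define S' where "S' = {y. (y - t) / c \<in> {a<..<b}}"
  have S': "open S'" unfolding S'_def
    using continuous_open_vimage[of "{a<..<b}" "\<lambda>y. (y - t) / c"] c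
    by (simp add: vimage_def continuous_intros)
  then have S'l: "S' \<in> sets lebesgue" by (simp add: lebesgue_openin)
  have eq: "t + c * x \<in> S' \<longleftrightarrow> x \<in> {a<..<b}" for x using c by (simp add: S'_def)
  have sub': "S' \<subseteq> {p<..<q}"
  proof
    fix y assume "y \<in> S'"
    then have "t + c * ((y - t) / c) \<in> {p<..<q}" by (intro sub) (simp add: S'_def)
    then show "y \<in> {p<..<q}" using c by simp
  qed
  note aff = lebesgue_on_affine[where S = "{a<..<b}", OF c _ S'l eq]
  have int: "integrable (lebesgue_on S') (\<lambda>x. (f x)\<^sup>2)"
    by (rule integrable_lebesgue_on_subset[OF L2_integrable_square[OF f] sub' S'l]) simp
  have "f \<in> borel_measurable (lebesgue_on S')"
    by (rule measurable_restrict_mono[OF L2_measurable[OF f] sub'])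
  then show "(\<lambda>x. f (t + c * x)) \<in> L2 a b"
    using int aff(1)[of "\<lambda>x. (f x)\<^sup>2"] aff(3)[of f] by (simp add: L2_def)
  have "(\<integral>x. (f (t + c * x))\<^sup>2 \<partial>lebesgue_on {a<..<b}) = (\<integral>x. (f x)\<^sup>2 \<partial>lebesgue_on S') / \<bar>c\<bar>"
    using aff(2)[of "\<lambda>x. (f x)\<^sup>2"] by simp
  also have "\<dots> \<le> (\<integral>x. (f x)\<^sup>2 \<partial>lebesgue_on {p<..<q}) / \<bar>c\<bar>"
    by (intro divide_right_mono integral_lebesgue_on_subset_mono L2_integrable_square f sub' S'l) auto
  finally show "L2_norm a b (\<lambda>x. f (t + c * x)) \<le> L2_norm p q f / sqrt \<bar>c\<bar>"
    unfolding L2_norm_def by (simp add: real_sqrt_divide[symmetric])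
qed

section \<open>The fundamental lemma of the calculus of variations\<close>

text \<open>The positive and the negative part of \<open>u\<close> are the densities of two finite measures that agree
  on all rays, hence are equal. The passage to a Borel representative is needed because rays generate
  the Borel sets but not all Lebesgue sets.\<close>
lemma AE_eq_0_if_integrals_over_rays_vanish:
  fixes u :: "real \<Rightarrow> real"
  assumes u: "integrable lebesgue u" and 0: "\<And>a. (\<integral>x. indicator {a<..} x * u x \<partial>lebesgue) = 0"
  shows "AE x in lebesgue. u x = 0"
proof -
  obtain w where w [measurable]: "w \<in> borel_measurable lborel" and ae: "AE x in lborel. u x = w x"
    using completion_ex_borel_measurable_real[of u lborel] u by auto
  have ae': "AE x in lebesgue. u x = w x" using ae by (rule AE_completion)
  have "integrable lebesgue w"
    using u by (rule Bochner_Integration.integrable_cong_AE[THEN iffD1, rotated -1])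
      (use u ae' in \<open>auto intro: measurable_completion\<close>)
  then have wi: "integrable lborel w" using w by (simp add: integrable_completion)
  have w0: "(\<integral>x. indicator {a<..} x * w x \<partial>lborel) = 0" for a
  proof -
    have "(\<integral>x. indicator {a<..} x * w x \<partial>lborel) = (\<integral>x. indicator {a<..} x * w x \<partial>lebesgue)"
      by (subst integral_completion) auto
    also have "\<dots> = (\<integral>x. indicator {a<..} x * u x \<partial>lebesgue)"
      by (rule integral_cong_AE) (use ae' u in \<open>auto intro!: borel_measurable_times intro: measurable_completion\<close>)
    finally show ?thesis using 0 by simp
  qed
  define P N where "P = density lborel (\<lambda>x. ennreal (max 0 (w x)))"
    and "N = density lborel (\<lambda>x. ennreal (max 0 (- w x)))"
  have ip: "integrable lborel (\<lambda>x. max 0 (w x) * indicator {a<..} x)" for a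
    by (rule Bochner_Integration.integrable_bound[OF wi]) (auto simp: indicator_def)
  have im: "integrable lborel (\<lambda>x. max 0 (- w x) * indicator {a<..} x)" for a
    by (rule Bochner_Integration.integrable_bound[OF wi]) (auto simp: indicator_def)
  have P: "emeasure P {a<..} = ennreal (\<integral>x. max 0 (w x) * indicator {a<..} x \<partial>lborel)" for a
    unfolding P_def using nn_integral_eq_integral[OF ip[of a]]
    by (simp add: emeasure_density ennreal_mult' ennreal_indicator[symmetric])
  have N: "emeasure N {a<..} = ennreal (\<integral>x. max 0 (- w x) * indicator {a<..} x \<partial>lborel)" for a
    unfolding N_def using nn_integral_eq_integral[OF im[of a]]
    by (simp add: emeasure_density ennreal_mult' ennreal_indicator[symmetric])
  have "P = N"
  proof (rule measure_eqI_lessThan)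
    fix a
    have "(\<integral>x. max 0 (w x) * indicator {a<..} x \<partial>lborel) - (\<integral>x. max 0 (- w x) * indicator {a<..} x \<partial>lborel)
      = (\<integral>x. indicator {a<..} x * w x \<partial>lborel)"
      by (subst Bochner_Integration.integral_diff[symmetric, OF ip im])
        (auto intro!: Bochner_Integration.integral_cong simp: indicator_def)
    then show "emeasure P {a<..} = emeasure N {a<..}" unfolding P N using w0[of a] by simp
  qed (auto simp: P, auto simp: P_def N_def)
  then have "AE x in lborel. ennreal (max 0 (w x)) = ennreal (max 0 (- w x))"
    unfolding P_def N_def by (intro sigma_finite_measure.density_unique[OF sigma_finite_lborel]) auto
  then have "AE x in lborel. w x = 0" by eventually_elim (auto simp: max_def split: if_splits)
  then have "AE x in lebesgue. w x = 0" by (rule AE_completion)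
  with ae' show ?thesis by eventually_elim simp
qed

text \<open>Letting the bumps steepen shows that the integral of \<open>u\<close> over each compactly contained interval
  vanishes; exhausting \<open>(m,b)\<close> from inside gives the rays.\<close>
lemma fundamental_lemma_bump:
  fixes u :: "real \<Rightarrow> real"
  assumes u: "integrable (lebesgue_on {a<..<b}) u"
    and 0: "\<And>k c d. a < c \<Longrightarrow> c < d \<Longrightarrow> d < b \<Longrightarrow> (\<integral>x. u x * bump k c d x \<partial>lebesgue_on {a<..<b}) = 0"
  shows "AE x in lebesgue_on {a<..<b}. u x = 0"
proof -
  let ?M = "lebesgue_on {a<..<b}"
  have m [measurable]: "u \<in> borel_measurable ?M" using u by simp
  have bm [measurable]: "bump k c d \<in> borel_measurable ?M" for k c d
    by (intro continuous_imp_measurable_on_sets_lebesgue continuous_on_bump) simp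
  have im [measurable]: "(indicator {c<..<d} :: real \<Rightarrow> real) \<in> borel_measurable ?M" for c d
    by (intro measurable_restrict_space1 borel_measurable_indicator) simp
  have int: "(\<integral>x. u x * indicator {c<..<d} x \<partial>?M) = 0" if "a < c" "c < d" "d < b" for c d
  proof -
    have "(\<lambda>k. \<integral>x. u x * bump k c d x \<partial>?M) \<longlonglongrightarrow> (\<integral>x. u x * indicator {c<..<d} x \<partial>?M)"
    proof (rule integral_dominated_convergence[where w="\<lambda>x. \<bar>u x\<bar>"])
      show "integrable ?M (\<lambda>x. \<bar>u x\<bar>)" using u by simp
      show "AE x in ?M. (\<lambda>k. u x * bump k c d x) \<longlonglongrightarrow> u x * indicator {c<..<d} x"
        by (intro AE_I2 tendsto_intros bump_tendsto_indicator)
      show "AE x in ?M. norm (u x * bump k c d x) \<le> \<bar>u x\<bar>" for k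
        by (intro AE_I2) (simp add: abs_mult mult_left_le bump_nonneg bump_le_1)
    qed auto
    then show ?thesis using 0[OF that] by (simp add: LIMSEQ_const_iff)
  qed
  have ray: "(\<integral>x. u x * indicator {m<..<b} x \<partial>?M) = 0" if "a \<le> m" "m < b" for m
  proof -
    define \<delta> where "\<delta> k = (b - m) / real (k + 3)" for k :: nat
    have \<delta>: "0 < \<delta> k" "2 * \<delta> k < b - m" for k
    proof -
      show "0 < \<delta> k" using that by (simp add: \<delta>_def)
      have "\<delta> k \<le> (b - m) / 3" unfolding \<delta>_def
        by (rule divide_left_mono) (use that in auto)
      then have "3 * \<delta> k \<le> b - m" by simp
      with \<open>m < b\<close> show "2 * \<delta> k < b - m" by argo
    qed
    have \<delta>0: "\<delta> \<longlonglongrightarrow> 0" unfolding \<delta>_def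
      by (rule LIMSEQ_ignore_initial_segment[OF lim_const_over_n])
    have "(\<lambda>k. \<integral>x. u x * indicator {m + \<delta> k<..<b - \<delta> k} x \<partial>?M) \<longlonglongrightarrow> (\<integral>x. u x * indicator {m<..<b} x \<partial>?M)"
    proof (rule integral_dominated_convergence[where w="\<lambda>x. \<bar>u x\<bar>"])
      show "integrable ?M (\<lambda>x. \<bar>u x\<bar>)" using u by simp
      have "(\<lambda>k. indicator {m + \<delta> k<..<b - \<delta> k} x) \<longlonglongrightarrow> (indicator {m<..<b} x :: real)" for x
      proof (cases "x \<in> {m<..<b}")
        case True
        then have "\<forall>\<^sub>F k in sequentially. \<delta> k < min (x - m) (b - x)"
          by (intro order_tendstoD(2)[OF \<delta>0]) auto
        then have "\<forall>\<^sub>F k in sequentially. (indicator {m<..<b} x :: real) = indicator {m + \<delta> k<..<b - \<delta> k} x"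
          by eventually_elim (use True in auto)
        then show ?thesis by (rule Lim_transform_eventually[OF tendsto_const])
      next
        case False
        then have "indicator {m + \<delta> k<..<b - \<delta> k} x = (0::real)" for k
          using \<delta>(1)[of k] by (auto simp: indicator_def)
        then show ?thesis using False by simp
      qed
      then show "AE x in ?M. (\<lambda>k. u x * indicator {m + \<delta> k<..<b - \<delta> k} x) \<longlonglongrightarrow> u x * indicator {m<..<b} x"
        by (intro AE_I2 tendsto_intros)
      show "AE x in ?M. norm (u x * indicator {m + \<delta> k<..<b - \<delta> k} x) \<le> \<bar>u x\<bar>" for k
        by (intro AE_I2) (simp add: indicator_def)
    qed auto
    moreover have "(\<integral>x. u x * indicator {m + \<delta> k<..<b - \<delta> k} x \<partial>?M) = 0" for k
      by (rule int) (use that \<delta>[of k] in linarith)+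
    ultimately show ?thesis by (simp add: LIMSEQ_const_iff)
  qed
  have "AE x in lebesgue. indicator {a<..<b} x *\<^sub>R u x = 0"
  proof (rule AE_eq_0_if_integrals_over_rays_vanish)
    show "integrable lebesgue (\<lambda>x. indicator {a<..<b} x *\<^sub>R u x)"
      using u by (simp add: integrable_restrict_space)
    fix y
    have "(\<integral>x. indicator {y<..} x * (indicator {a<..<b} x *\<^sub>R u x) \<partial>lebesgue) =
        (\<integral>x. u x * indicator {max y a<..<b} x \<partial>?M)"
      by (simp add: integral_restrict_space)
        (intro Bochner_Integration.integral_cong, auto simp: indicator_def)
    also have "\<dots> = 0"
    proof (cases "max y a < b")
      case True
      then show ?thesis by (intro ray) auto
    next
      case False
      then have "{max y a<..<b} = {}" by (intro greaterThanLessThan_empty) linarith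
      then show ?thesis by simp
    qed
    finally show "(\<integral>x. indicator {y<..} x * (indicator {a<..<b} x *\<^sub>R u x) \<partial>lebesgue) = 0" .
  qed
  then show ?thesis by (simp add: AE_restrict_space_iff) (auto elim: eventually_mono)
qed

section \<open>Identifying weak derivatives through smooth approximations\<close>

lemma L2_weak_limit:
  assumes F: "\<And>N. F N \<in> L2 a b" and f: "f \<in> L2 a b" and g: "g \<in> L2 a b"
    and lim: "(\<lambda>N. L2_norm a b (\<lambda>x. F N x - f x)) \<longlonglongrightarrow> 0"
  shows "(\<lambda>N. \<integral>x. F N x * g x \<partial>lebesgue_on {a<..<b}) \<longlonglongrightarrow> (\<integral>x. f x * g x \<partial>lebesgue_on {a<..<b})"
proof (rule LIM_zero_cancel, rule Lim_null_comparison)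
  show "(\<lambda>N. L2_norm a b (\<lambda>x. F N x - f x) * L2_norm a b g) \<longlonglongrightarrow> 0"
    using tendsto_mult_right[OF lim, of "L2_norm a b g"] by simp
  show "\<forall>\<^sub>F N in sequentially. norm ((\<integral>x. F N x * g x \<partial>lebesgue_on {a<..<b}) -
      (\<integral>x. f x * g x \<partial>lebesgue_on {a<..<b})) \<le> L2_norm a b (\<lambda>x. F N x - f x) * L2_norm a b g"
  proof (rule always_eventually, rule allI)
    fix N
    show "norm ((\<integral>x. F N x * g x \<partial>lebesgue_on {a<..<b}) -
      (\<integral>x. f x * g x \<partial>lebesgue_on {a<..<b})) \<le> L2_norm a b (\<lambda>x. F N x - f x) * L2_norm a b g"
      using L2_Cauchy_Schwarz[OF L2_diff[OF F[of N] f] g]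
      by (simp add: left_diff_distrib L2_integrable_mult[OF F g] L2_integrable_mult[OF f g])
  qed
qed

lemma bump_integral_by_parts:
  assumes W: "\<And>x. (W has_real_derivative D x) (at x)" "continuous_on UNIV D"
    and cd: "a < c" "c < d" "d < b"
  shows "(\<integral>x. W x * deriv (bump k c d) x \<partial>lebesgue_on {a<..<b}) =
      - (\<integral>x. D x * bump k c d x \<partial>lebesgue_on {a<..<b})"
proof -
  have cW: "continuous_on {a..b} W"
    by (meson DERIV_isCont W(1) continuous_at_imp_continuous_on)
  have cD: "continuous_on {a..b} D" using W(2) continuous_on_subset by blast
  have i1: "continuous_on {a..b} (\<lambda>x. W x * deriv (bump k c d) x)"
    by (intro continuous_intros cW continuous_on_deriv_bump)
  have i2: "continuous_on {a..b} (\<lambda>x. D x * bump k c d x)"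
    by (intro continuous_intros cD continuous_on_bump)
  have "((\<lambda>x. W x * deriv (bump k c d) x + D x * bump k c d x) has_integral
      W b * bump k c d b - W a * bump k c d a) {a..b}"
  proof (rule fundamental_theorem_of_calculus)
    show "((\<lambda>x. W x * bump k c d x) has_vector_derivative
        W x * deriv (bump k c d) x + D x * bump k c d x) (at x within {a..b})" for x
      unfolding has_real_derivative_iff_has_vector_derivative[symmetric]
      using DERIV_mult[OF W(1)[of x] bump_has_deriv[of k c d x]]
      by (auto simp: algebra_simps intro: has_field_derivative_at_within)
  qed (use cd in simp)
  then have "integral {a..b} (\<lambda>x. W x * deriv (bump k c d) x + D x * bump k c d x) = 0"
    using cd by (simp add: bump_eq_0 integral_unique)
  then show ?thesis
    using i1 i2 by (simp add: continuous_integral_Ioo integral_add integrable_continuous_real)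
qed

text \<open>Integration by parts for the smooth \<open>W N\<close> passes to the limit on both sides, so \<open>d\<close> and \<open>d'\<close> have
  the same integral against every bump. Only bumps are required as test functions, so that the lemma
  also applies in the time variable, where the weak equation is available for products only.\<close>
lemma weak_derivative_of_limit:
  assumes w: "w \<in> L2 a b" and d: "d \<in> L2 a b" and d': "d' \<in> L2 a b"
    and weak: "\<And>k c e. a < c \<Longrightarrow> c < e \<Longrightarrow> e < b \<Longrightarrow>
      (\<integral>x. w x * deriv (bump k c e) x \<partial>lebesgue_on {a<..<b}) =
      - (\<integral>x. d x * bump k c e x \<partial>lebesgue_on {a<..<b})"
    and W: "\<And>N x. (W N has_real_derivative D N x) (at x)" and D: "\<And>N. continuous_on UNIV (D N)"
    and limW: "(\<lambda>N. L2_norm a b (\<lambda>x. W N x - w x)) \<longlonglongrightarrow> 0"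
    and limD: "(\<lambda>N. L2_norm a b (\<lambda>x. D N x - d' x)) \<longlonglongrightarrow> 0"
  shows "AE x in lebesgue_on {a<..<b}. d x = d' x"
proof -
  have WL: "W N \<in> L2 a b" for N
    by (intro continuous_L2) (meson DERIV_isCont W continuous_at_imp_continuous_on)
  have DL: "D N \<in> L2 a b" for N
    by (intro continuous_L2) (meson D continuous_on_subset subset_UNIV)
  have "AE x in lebesgue_on {a<..<b}. d x - d' x = 0"
  proof (rule fundamental_lemma_bump)
    show "integrable (lebesgue_on {a<..<b}) (\<lambda>x. d x - d' x)"
      by (intro L2_integrable L2_diff d d')
    fix k c e assume ce: "a < c" "c < e" "e < b"
    have b: "bump k c e \<in> L2 a b" "deriv (bump k c e) \<in> L2 a b"
      by (intro continuous_L2 continuous_on_bump continuous_on_deriv_bump)+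
    have "(\<lambda>N. - (\<integral>x. D N x * bump k c e x \<partial>lebesgue_on {a<..<b})) \<longlonglongrightarrow>
        - (\<integral>x. d' x * bump k c e x \<partial>lebesgue_on {a<..<b})"
      by (intro tendsto_minus L2_weak_limit DL d' b limD)
    moreover have "(\<lambda>N. \<integral>x. W N x * deriv (bump k c e) x \<partial>lebesgue_on {a<..<b}) \<longlonglongrightarrow>
        (\<integral>x. w x * deriv (bump k c e) x \<partial>lebesgue_on {a<..<b})"
      by (intro L2_weak_limit WL w b limW)
    ultimately have "(\<integral>x. d' x * bump k c e x \<partial>lebesgue_on {a<..<b}) =
        (\<integral>x. d x * bump k c e x \<partial>lebesgue_on {a<..<b})"
      unfolding bump_integral_by_parts[OF W D ce] weak[OF ce]
      using LIMSEQ_unique by fastforce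
    then show "(\<integral>x. (d x - d' x) * bump k c e x \<partial>lebesgue_on {a<..<b}) = 0"
      by (simp add: left_diff_distrib L2_integrable_mult[OF d b(1)] L2_integrable_mult[OF d' b(1)])
  qed
  then show ?thesis by simp
qed

lemma bump_lipschitz: "\<exists>B\<ge>0. \<forall>x y. \<bar>bump k c d x - bump k c d y\<bar> \<le> B * \<bar>x - y\<bar>"
proof -
  have "compact (deriv (bump k c d) ` {c..d})"
    by (intro compact_continuous_image continuous_on_deriv_bump compact_Icc)
  then obtain B where B: "\<And>x. x \<in> {c..d} \<Longrightarrow> \<bar>deriv (bump k c d) x\<bar> \<le> B"
    by (metis bounded_iff compact_imp_bounded imageI real_norm_def)
  have "\<bar>deriv (bump k c d) x\<bar> \<le> \<bar>B\<bar>" for x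
    using B[of x] deriv_bump_eq_0[of x c d k] by (cases "x \<in> {c..d}") auto
  then have "\<bar>bump k c d x - bump k c d y\<bar> \<le> \<bar>B\<bar> * \<bar>x - y\<bar>" for x y
    using field_differentiable_bound[OF convex_UNIV, of "bump k c d" "deriv (bump k c d)" "\<bar>B\<bar>" x y]
    by (simp add: bump_has_deriv)
  then show ?thesis by (intro exI[of _ "\<bar>B\<bar>"]) auto
qed

text \<open>After translation to the fixed interval \<open>(0,L)\<close>, time enters both factors: \<open>f\<close> depends
  continuously on it in \<open>L\<^sup>2\<close> by hypothesis, and the translated bump is Lipschitz in it.\<close>
lemma pairing_continuous:
  assumes C: "C_L2 L v T f" and L: "0 < L"
  shows "continuous_on {0..T} (\<lambda>t. \<integral>x. f x t * bump k c d x \<partial>lebesgue_on {v * t<..<L + v * t})"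
proof -
  define Y where "Y t y = f (y + v * t) t" for t y
  define H where "H t y = bump k c d (y + v * t)" for t y
  define p where "p t = (\<integral>x. f x t * bump k c d x \<partial>lebesgue_on {v * t<..<L + v * t})" for t
  obtain B where B: "0 \<le> B" "\<And>x y. \<bar>bump k c d x - bump k c d y\<bar> \<le> B * \<bar>x - y\<bar>"
    using bump_lipschitz[of k c d] by blast
  have p: "p t = (\<integral>y. Y t y * H t y \<partial>lebesgue_on {0<..<L})" for t
    using lebesgue_on_affine(2)[of 1 "{0<..<L}" "{v * t<..<L + v * t}" "v * t" "\<lambda>x. f x t * bump k c d x"]
    by (simp add: p_def Y_def H_def add.commute)
  have Y: "Y t \<in> L2 0 L" if "t \<in> {0..T}" for t
    using L2_affine(1)[of "\<lambda>x. f x t" "v * t" "L + v * t" 1 0 L "v * t"] C that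
    by (simp add: C_L2_def Y_def[abs_def] add.commute)
  have H: "H t \<in> L2 0 L" for t
  proof -
    have "continuous_on {0..L} (\<lambda>y. y + v * t)" by (intro continuous_intros)
    then have "continuous_on {0..L} (H t)"
      unfolding H_def[abs_def] by (rule continuous_on_compose2[OF continuous_on_bump[of UNIV]]) simp
    then show ?thesis by (rule continuous_L2)
  qed
  have H1: "L2_norm 0 L (H t) \<le> 1 * sqrt (L - 0)" for t
    by (intro L2_norm_bounded(2) L2_measurable H AE_I2)
      (use L in \<open>auto simp: H_def bump_nonneg bump_le_1\<close>)
  have HH: "L2_norm 0 L (\<lambda>y. H s y - H t y) \<le> (B * (\<bar>v\<bar> * \<bar>s - t\<bar>)) * sqrt (L - 0)" for s t
  proof (intro L2_norm_bounded(2) L2_measurable L2_diff H AE_I2)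
    fix y
    have "\<bar>y + v * s - (y + v * t)\<bar> = \<bar>v\<bar> * \<bar>s - t\<bar>"
      by (simp add: abs_mult[symmetric] algebra_simps)
    then show "\<bar>H s y - H t y\<bar> \<le> B * (\<bar>v\<bar> * \<bar>s - t\<bar>)"
      using B(2)[of "y + v * s" "y + v * t"] by (simp add: H_def)
  qed (use L B(1) in auto)
  have "(p \<longlongrightarrow> p t) (at t within {0..T})" if t: "t \<in> {0..T}" for t
  proof (rule LIM_zero_cancel, rule Lim_null_comparison)
    have "((\<lambda>s. L2_norm 0 L (\<lambda>y. Y s y - Y t y)) \<longlongrightarrow> 0) (at t within {0..T})"
      using C t by (auto simp: C_L2_def Y_def)
    moreover have "((\<lambda>s. \<bar>s - t\<bar>) \<longlongrightarrow> 0) (at t within {0..T})"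
      by (auto intro!: tendsto_eq_intros)
    ultimately show "((\<lambda>s. L2_norm 0 L (\<lambda>y. Y s y - Y t y) * sqrt L +
        L2_norm 0 L (Y t) * (B * (\<bar>v\<bar> * \<bar>s - t\<bar>) * sqrt L)) \<longlongrightarrow> 0) (at t within {0..T})"
      by (auto intro!: tendsto_eq_intros)
    show "\<forall>\<^sub>F s in at t within {0..T}. norm (p s - p t) \<le> L2_norm 0 L (\<lambda>y. Y s y - Y t y) * sqrt L +
        L2_norm 0 L (Y t) * (B * (\<bar>v\<bar> * \<bar>s - t\<bar>) * sqrt L)"
      unfolding eventually_at_filter
    proof (intro always_eventually allI impI)
      fix s assume "s \<in> {0..T}"
      note Ys = Y[OF this] and Yt = Y[OF t]
      have eq: "p s - p t = (\<integral>y. (Y s y - Y t y) * H s y \<partial>lebesgue_on {0<..<L}) +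
          (\<integral>y. Y t y * (H s y - H t y) \<partial>lebesgue_on {0<..<L})"
        unfolding p by (simp add: left_diff_distrib right_diff_distrib L2_integrable_mult Ys Yt H)
      have "\<bar>p s - p t\<bar> \<le> L2_norm 0 L (\<lambda>y. Y s y - Y t y) * L2_norm 0 L (H s) +
          L2_norm 0 L (Y t) * L2_norm 0 L (\<lambda>y. H s y - H t y)"
        unfolding eq using L2_Cauchy_Schwarz[OF L2_diff[OF Ys Yt] H[of s]]
          L2_Cauchy_Schwarz[OF Yt L2_diff[OF H[of s] H[of t]]] by linarith
      also have "\<dots> \<le> L2_norm 0 L (\<lambda>y. Y s y - Y t y) * sqrt L +
        L2_norm 0 L (Y t) * (B * (\<bar>v\<bar> * \<bar>s - t\<bar>) * sqrt L)"
        using H1[of s] HH[of s t] by (intro add_mono mult_left_mono) auto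
      finally show "norm (p s - p t) \<le> L2_norm 0 L (\<lambda>y. Y s y - Y t y) * sqrt L +
        L2_norm 0 L (Y t) * (B * (\<bar>v\<bar> * \<bar>s - t\<bar>) * sqrt L)" by simp
    qed
  qed
  then show ?thesis unfolding continuous_on_def p_def by blast
qed

text \<open>The weak form of \<open>\<partial>\<phi>/\<partial>t = \<phi>\<^sub>t\<close>, tested with a product of a bump in space and one in time: it says
  that the spatial pairing \<open>p\<close> is the weak time derivative of the spatial pairing \<open>m\<close>.\<close>
lemma weak_solution_against_bumps:
  fixes k j :: nat and s e c d \<delta> :: real
  assumes sol: "weak_solution L v \<phi>0 \<phi>1 \<phi> \<phi>x \<phi>t" and v: "0 < v"
    and "0 < s" "s < e" "v * e < c" "d < L" "e < \<delta>"
  defines "m \<equiv> \<lambda>t. \<integral>x. \<phi> x t * bump k c d x \<partial>lebesgue_on {v * t<..<L + v * t}"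
    and "p \<equiv> \<lambda>t. \<integral>x. \<phi>t x t * bump k c d x \<partial>lebesgue_on {v * t<..<L + v * t}"
  shows "(\<integral>t. m t * deriv (bump j s e) t \<partial>lebesgue_on {0<..<\<delta>}) =
      - (\<integral>t. p t * bump j s e t \<partial>lebesgue_on {0<..<\<delta>})"
proof -
  let ?\<theta> = "\<lambda>z. bump k c d (fst z) * bump j s e (snd z)"
  have "?\<theta> \<in> test_functions (strip L v)"
    by (rule bump_product_test_function) (use assms in auto)
  then have eq: "strip_integral L v (\<lambda>x t. \<phi> x t * partial_t ?\<theta> x t) =
      - strip_integral L v (\<lambda>x t. \<phi>t x t * ?\<theta> (x, t))"
    using sol unfolding weak_solution_def by blast
  have pt: "partial_t ?\<theta> x t = bump k c d x * deriv (bump j s e) t" for x t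
    unfolding partial_t_def
    by (rule DERIV_imp_deriv) (auto intro!: DERIV_cmult bump_has_deriv)
  have supp: "integral\<^sup>L (lebesgue_on {0<..}) f = integral\<^sup>L (lebesgue_on {0<..<\<delta>}) f"
    if "\<And>t. t \<notin> {s..e} \<Longrightarrow> f t = 0" for f :: "real \<Rightarrow> real"
    by (rule integral_lebesgue_on_support) (use that assms in auto)
  have "strip_integral L v (\<lambda>x t. \<phi> x t * partial_t ?\<theta> x t) =
      (\<integral>t. m t * deriv (bump j s e) t \<partial>lebesgue_on {0<..})"
    unfolding strip_integral_def pt m_def by (simp add: mult.assoc[symmetric])
  also have "\<dots> = (\<integral>t. m t * deriv (bump j s e) t \<partial>lebesgue_on {0<..<\<delta>})"
    by (rule supp) (simp add: deriv_bump_eq_0)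
  finally have 1: "strip_integral L v (\<lambda>x t. \<phi> x t * partial_t ?\<theta> x t) =
      (\<integral>t. m t * deriv (bump j s e) t \<partial>lebesgue_on {0<..<\<delta>})" .
  have "strip_integral L v (\<lambda>x t. \<phi>t x t * ?\<theta> (x, t)) =
      (\<integral>t. p t * bump j s e t \<partial>lebesgue_on {0<..})"
    unfolding strip_integral_def p_def by (simp add: mult.assoc[symmetric])
  also have "\<dots> = (\<integral>t. p t * bump j s e t \<partial>lebesgue_on {0<..<\<delta>})"
    by (rule supp) (auto simp: bump_eq_0)
  finally show ?thesis using 1 eq by simp
qed

lemma AE_eq_continuous_imp_eq:
  fixes p q :: "real \<Rightarrow> real"
  assumes ab: "a < b" and c: "continuous_on {a..b} p" "continuous_on {a..b} q"
    and ae: "AE t in lebesgue_on {a<..<b}. p t = q t" and t: "t \<in> {a..b}"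
  shows "p t = q t"
proof -
  have cont: "continuous_on {a..b} (\<lambda>t. \<bar>p t - q t\<bar>)" by (intro continuous_intros c)
  have "integral {a..b} (\<lambda>t. \<bar>p t - q t\<bar>) = (\<integral>t. \<bar>p t - q t\<bar> \<partial>lebesgue_on {a<..<b})"
    using continuous_integral_Ioo[OF cont] by simp
  also have "\<dots> = 0"
    by (rule integral_eq_zero_AE) (use ae in eventually_elim, simp)
  finally show ?thesis using integral_eq_0_iff[OF cont ab] t by force
qed

text \<open>Pairing with a bump in space leaves functions of time alone. On \<open>(0,\<delta>)\<close> the pairing of
  \<open>\<phi>t\<close> is the weak derivative of the pairing of \<open>\<phi>\<close>, and the latter is a uniform limit of the smooth
  pairings \<open>M N\<close> whose derivatives \<open>Q N\<close> converge to the pairing of \<open>\<psi>\<close>. So the pairings of \<open>\<phi>t\<close> and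
  \<open>\<psi>\<close> agree almost everywhere on \<open>(0,\<delta>)\<close>; both are continuous up to 0, hence they agree at 0.\<close>
lemma time_derivative_at_0_of_limit:
  assumes sol: "weak_solution L v \<phi>0 \<phi>1 \<phi> \<phi>x \<phi>t" and L: "0 < L" and v: "0 < v" and \<epsilon>: "0 < \<epsilon>"
    and \<Phi>: "\<And>N x t. (\<Phi> N x has_real_derivative \<Psi> N x t) (at t)"
    and c\<Phi>: "\<And>N. continuous_on UNIV (\<lambda>(t, x). \<Phi> N x t)"
    and c\<Psi>: "\<And>N. continuous_on UNIV (\<lambda>(t, x). \<Psi> N x t)"
    and E: "E \<longlonglongrightarrow> 0"
    and lim\<Phi>: "\<And>N t. 0 \<le> t \<Longrightarrow> t \<le> \<epsilon> \<Longrightarrow> L2_norm (v * t) (L + v * t) (\<lambda>x. \<Phi> N x t - \<phi> x t) \<le> E N"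
    and \<psi>: "\<And>t. 0 \<le> t \<Longrightarrow> t \<le> \<epsilon> \<Longrightarrow> (\<lambda>x. \<psi> x t) \<in> L2 (v * t) (L + v * t)"
    and lim\<Psi>: "\<And>N t. 0 \<le> t \<Longrightarrow> t \<le> \<epsilon> \<Longrightarrow> L2_norm (v * t) (L + v * t) (\<lambda>x. \<Psi> N x t - \<psi> x t) \<le> E N"
  shows "AE x in lebesgue_on {0<..<L}. \<phi>t x 0 = \<psi> x 0"
proof -
  have CH: "C_H10 L v \<epsilon> \<phi> \<phi>x" "C_L2 L v \<epsilon> \<phi>t" using sol \<epsilon> by (auto simp: weak_solution_def)
  then have C\<phi>: "C_L2 L v \<epsilon> \<phi>" by (simp add: C_H10_def)
  have \<phi>L: "(\<lambda>x. \<phi> x t) \<in> L2 (v * t) (L + v * t)" if "0 \<le> t" "t \<le> \<epsilon>" for t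
    using C\<phi> that by (auto simp: C_L2_def)
  have \<phi>t0: "(\<lambda>x. \<phi>t x 0) \<in> L2 0 L" using CH(2) \<epsilon> by (force simp: C_L2_def)
  have \<psi>0: "(\<lambda>x. \<psi> x 0) \<in> L2 0 L" using \<psi>[of 0] \<epsilon> by simp
  have "AE x in lebesgue_on {0<..<L}. \<phi>t x 0 - \<psi> x 0 = 0"
  proof (rule fundamental_lemma_bump)
    show "integrable (lebesgue_on {0<..<L}) (\<lambda>x. \<phi>t x 0 - \<psi> x 0)"
      by (intro L2_integrable L2_diff \<phi>t0 \<psi>0)
    fix k c d assume cd: "0 < c" "c < d" "d < L"
    \<comment> \<open>Up to time \<open>c / v\<close> the moving interval still contains \<open>(c,d)\<close>.\<close>
    define \<delta> where "\<delta> = min \<epsilon> (c / v)"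
    have \<delta>: "0 < \<delta>" "\<delta> \<le> \<epsilon>" "v * \<delta> \<le> c"
      using \<epsilon> v cd by (auto simp: \<delta>_def min_def field_simps)
    define J where "J t = {v * t<..<L + v * t}" for t
    define pair where "pair f t = (\<integral>x. f x t * bump k c d x \<partial>lebesgue_on (J t))" for f t
    have vt: "v * t \<le> c" "0 \<le> v * t" if "t \<in> {0..\<delta>}" for t
    proof -
      have "v * t \<le> v * \<delta>" using that v by (intro mult_left_mono) auto
      then show "v * t \<le> c" using \<delta> by linarith
      show "0 \<le> v * t" using that v by simp
    qed
    have bL: "bump k c d \<in> L2 a b" for a b by (intro continuous_L2 continuous_on_bump)
    have b1: "L2_norm (v * t) (L + v * t) (bump k c d) \<le> sqrt L" for t
      using L2_norm_bounded(2)[of "v * t" "L + v * t" "bump k c d" 1] L2_measurable[OF bL] L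
      by (auto simp: bump_nonneg bump_le_1)
    have smooth_pair: "pair F t = integral {c..d} (\<lambda>x. F x t * bump k c d x)"
      if "continuous_on UNIV (\<lambda>(t, x). F x t)" "t \<in> {0..\<delta>}" for F t
    proof -
      have cF: "continuous_on {c..d} (\<lambda>x. F x t)"
        using continuous_on_compose2[OF that(1), of "{c..d}" "\<lambda>x. (t, x)"] by (simp add: continuous_intros)
      have "pair F t = (\<integral>x. F x t * bump k c d x \<partial>lebesgue_on {c<..<d})"
        unfolding pair_def J_def
        by (rule integral_lebesgue_on_support) (use vt[OF that(2)] cd in \<open>auto simp: bump_eq_0\<close>)
      also have "\<dots> = integral {c..d} (\<lambda>x. F x t * bump k c d x)"
        by (intro continuous_integral_Ioo continuous_intros cF continuous_on_bump)
      finally show ?thesis .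
    qed
    define M where "M N t = integral {c..d} (\<lambda>x. \<Phi> N x t * bump k c d x)" for N t
    define Q where "Q N t = integral {c..d} (\<lambda>x. \<Psi> N x t * bump k c d x)" for N t
    have cb: "continuous_on UNIV (\<lambda>(t, x). F x t * bump k c d x)"
      if "continuous_on UNIV (\<lambda>(t, x). F x t)" for F :: "real \<Rightarrow> real \<Rightarrow> real"
    proof -
      have "continuous_on UNIV (\<lambda>z. (case z of (t, x) \<Rightarrow> F x t) * bump k c d (snd z))"
        by (intro continuous_intros that continuous_on_compose2[OF continuous_on_bump[of UNIV], of _ snd]) auto
      then show ?thesis by (simp add: case_prod_unfold)
    qed
    have MQ: "(M N has_real_derivative Q N t) (at t)" for N t
    proof -
      have "((\<lambda>t. integral (cbox c d) (\<lambda>x. \<Phi> N x t * bump k c d x)) has_real_derivative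
          integral (cbox c d) (\<lambda>x. \<Psi> N x t * bump k c d x)) (at t within UNIV)"
      proof (rule leibniz_rule_field_derivative)
        show "((\<lambda>t. \<Phi> N x t * bump k c d x) has_real_derivative \<Psi> N x t * bump k c d x) (at t within UNIV)" for x t
          using DERIV_cmult_right[OF \<Phi>[of N x t]] by simp
        show "(\<lambda>x. \<Phi> N x t * bump k c d x) integrable_on cbox c d" for t
          using continuous_on_compose2[OF cb[OF c\<Phi>[of N]], of "cbox c d" "\<lambda>x. (t, x)"]
          by (intro integrable_continuous) (simp add: continuous_intros)
        show "continuous_on (UNIV \<times> cbox c d) (\<lambda>(t, x). \<Psi> N x t * bump k c d x)"
          by (rule continuous_on_subset[OF cb[OF c\<Psi>]]) auto
      qed auto
      then show ?thesis by (simp add: M_def[abs_def] Q_def)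
    qed
    have cQ: "continuous_on UNIV (Q N)" for N
    proof -
      have "continuous_on UNIV (\<lambda>t. integral (cbox c d) (\<lambda>x. \<Psi> N x t * bump k c d x))"
        by (rule integral_continuous_on_param) (rule continuous_on_subset[OF cb[OF c\<Psi>]], auto)
      then show ?thesis by (simp add: Q_def[abs_def])
    qed
    have cM: "continuous_on S (M N)" for N S
      by (meson DERIV_isCont MQ continuous_at_imp_continuous_on)
    have close: "\<bar>pair F t - pair f t\<bar> \<le> E N * sqrt L"
      if "continuous_on UNIV (\<lambda>(t, x). F x t)" "t \<in> {0..\<delta>}" "(\<lambda>x. f x t) \<in> L2 (v * t) (L + v * t)"
        "L2_norm (v * t) (L + v * t) (\<lambda>x. F x t - f x t) \<le> E N" for F f t N
    proof -
      have F: "(\<lambda>x. F x t) \<in> L2 (v * t) (L + v * t)"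
        using continuous_on_compose2[OF that(1), of "{v * t..L + v * t}" "\<lambda>x. (t, x)"]
        by (intro continuous_L2) (simp add: continuous_intros)
      have eq: "pair F t - pair f t =
          (\<integral>x. (F x t - f x t) * bump k c d x \<partial>lebesgue_on (J t))"
        unfolding pair_def J_def left_diff_distrib
        by (simp add: L2_integrable_mult[OF F bL] L2_integrable_mult[OF that(3) bL])
      have "\<bar>pair F t - pair f t\<bar> \<le> L2_norm (v * t) (L + v * t) (\<lambda>x. F x t - f x t) * L2_norm (v * t) (L + v * t) (bump k c d)"
        unfolding eq J_def by (intro L2_Cauchy_Schwarz L2_diff F that bL)
      also have "\<dots> \<le> E N * sqrt L"
        using that(4) b1[of t] by (intro mult_mono) (auto intro: order_trans[OF L2_norm_nonneg])
      finally show ?thesis .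
    qed
    have M: "\<bar>M N t - pair \<phi> t\<bar> \<le> E N * sqrt L" if "t \<in> {0..\<delta>}" for N t
      using close[OF c\<Phi>[of N] that, of \<phi> N] \<phi>L[of t] lim\<Phi>[of t N] smooth_pair[OF c\<Phi>[of N] that] that \<delta>
      by (simp add: M_def)
    have Q: "\<bar>Q N t - pair \<psi> t\<bar> \<le> E N * sqrt L" if "t \<in> {0..\<delta>}" for N t
      using close[OF c\<Psi>[of N] that, of \<psi> N] \<psi>[of t] lim\<Psi>[of t N] smooth_pair[OF c\<Psi>[of N] that] that \<delta>
      by (simp add: Q_def)
    have E': "(\<lambda>N. E N * sqrt L) \<longlonglongrightarrow> 0" using tendsto_mult_right[OF E, of "sqrt L"] by simp
    have q: "continuous_on {0..\<delta>} (pair \<psi>)"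
    proof (rule uniform_limit_theorem[OF _ _ sequentially_bot])
      show "\<forall>\<^sub>F N in sequentially. continuous_on {0..\<delta>} (Q N)"
        by (intro always_eventually allI continuous_on_subset[OF cQ]) auto
      show "uniform_limit {0..\<delta>} Q (pair \<psi>) sequentially"
        unfolding uniform_limit_iff
      proof (intro allI impI)
        fix \<eta> :: real assume "0 < \<eta>"
        then have "\<forall>\<^sub>F N in sequentially. E N * sqrt L < \<eta>" by (rule order_tendstoD[OF E'])
        then show "\<forall>\<^sub>F N in sequentially. \<forall>t\<in>{0..\<delta>}. dist (Q N t) (pair \<psi> t) < \<eta>"
        proof eventually_elim
          case (elim N)
          show ?case unfolding dist_real_def using le_less_trans[OF Q elim] by blast
        qed
      qed
    qed
    have m: "continuous_on {0..\<delta>} (pair \<phi>)"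
      unfolding pair_def[abs_def] J_def
      by (rule continuous_on_subset[OF pairing_continuous[OF C\<phi> L]]) (use \<delta>(2) in auto)
    have p: "continuous_on {0..\<delta>} (pair \<phi>t)"
      unfolding pair_def[abs_def] J_def
      by (rule continuous_on_subset[OF pairing_continuous[OF CH(2) L]]) (use \<delta>(2) in auto)
    have ae: "AE t in lebesgue_on {0<..<\<delta>}. pair \<phi>t t = pair \<psi> t"
    proof (rule weak_derivative_of_limit[where w="pair \<phi>" and W=M and D=Q])
      fix j s e assume se: "0 < s" "s < e" "e < \<delta>"
      have "v * e < c" using mult_strict_left_mono[OF se(3) v] \<delta>(3) by linarith
      then show "(\<integral>t. pair \<phi> t * deriv (bump j s e) t \<partial>lebesgue_on {0<..<\<delta>}) =
          - (\<integral>t. pair \<phi>t t * bump j s e t \<partial>lebesgue_on {0<..<\<delta>})"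
        unfolding pair_def J_def using weak_solution_against_bumps[OF sol v se(1,2) _ cd(3) se(3)] by blast
    next
      have "L2_norm 0 \<delta> (\<lambda>t. M N t - pair \<phi> t) \<le> (E N * sqrt L) * sqrt (\<delta> - 0)" for N
        by (rule L2_norm_bounded(2))
          (use \<delta> M[of _ N] order_trans[OF abs_ge_zero M[of 0 N]] in
            \<open>auto intro!: L2_measurable continuous_L2 continuous_on_diff cM m\<close>)
      then show "(\<lambda>N. L2_norm 0 \<delta> (\<lambda>t. M N t - pair \<phi> t)) \<longlonglongrightarrow> 0"
        by (intro Lim_null_comparison[OF _ tendsto_mult_left_zero[OF E', of "sqrt (\<delta> - 0)"]] always_eventually) simp
      have "L2_norm 0 \<delta> (\<lambda>t. Q N t - pair \<psi> t) \<le> (E N * sqrt L) * sqrt (\<delta> - 0)" for N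
        by (rule L2_norm_bounded(2))
          (use \<delta> Q[of _ N] order_trans[OF abs_ge_zero Q[of 0 N]] continuous_on_subset[OF cQ] in
            \<open>auto intro!: L2_measurable continuous_L2 continuous_on_diff q\<close>)
      then show "(\<lambda>N. L2_norm 0 \<delta> (\<lambda>t. Q N t - pair \<psi> t)) \<longlonglongrightarrow> 0"
        by (intro Lim_null_comparison[OF _ tendsto_mult_left_zero[OF E', of "sqrt (\<delta> - 0)"]] always_eventually) simp
    qed (use m p q MQ cQ in \<open>auto intro: continuous_L2\<close>)
    have "pair \<phi>t 0 = pair \<psi> 0"
      by (rule AE_eq_continuous_imp_eq[OF \<delta>(1) p q ae]) (use \<delta> in auto)
    then show "(\<integral>x. (\<phi>t x 0 - \<psi> x 0) * bump k c d x \<partial>lebesgue_on {0<..<L}) = 0"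
      by (simp add: pair_def J_def left_diff_distrib L2_integrable_mult[OF \<phi>t0 bL] L2_integrable_mult[OF \<psi>0 bL])
  qed
  then show ?thesis by simp
qed

section \<open>The profile of the travelling waves\<close>

text \<open>Partial sums of the profile \<open>F\<close> with \<open>\<phi>(x,t) = F((1 - v)(t + x)) - F((1 + v)(t - x))\<close>, and their
  derivatives.\<close>
definition fourier_sum :: "real \<Rightarrow> (int \<Rightarrow> complex) \<Rightarrow> nat \<Rightarrow> real \<Rightarrow> complex" where
  "fourier_sum L c N y = (\<Sum>n\<in>{- int N..int N} - {0}. c n * cis (of_int n * pi / L * y))"

definition fourier_deriv :: "real \<Rightarrow> (int \<Rightarrow> complex) \<Rightarrow> nat \<Rightarrow> real \<Rightarrow> complex" where
  "fourier_deriv L c N y =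
     (\<Sum>n\<in>{- int N..int N} - {0}. c n * (\<i> * complex_of_real (of_int n * pi / L) * cis (of_int n * pi / L * y)))"

lemma has_vector_derivative_cis_affine:
  "((\<lambda>x. cis (a + b * x)) has_vector_derivative \<i> * complex_of_real b * cis (a + b * x)) (at x within S)"
  unfolding has_vector_derivative_def
  by (auto intro!: derivative_eq_intros simp: scaleR_conv_of_real algebra_simps)

lemma fourier_sum_has_vector_derivative:
  "(fourier_sum L c N has_vector_derivative fourier_deriv L c N y) (at y)"
  unfolding fourier_sum_def[abs_def] fourier_deriv_def
  by (intro has_vector_derivative_sum has_vector_derivative_mult_right
      has_vector_derivative_cis_affine[of 0, simplified])

lemma Re_fourier_sum_has_derivative:
  "((\<lambda>y. Re (fourier_sum L c N y)) has_real_derivative Re (fourier_deriv L c N y)) (at y)"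
  unfolding has_real_derivative_iff_has_vector_derivative
  by (rule bounded_linear.has_vector_derivative[OF bounded_linear_Re fourier_sum_has_vector_derivative])

lemma continuous_on_fourier_deriv: "continuous_on S (fourier_deriv L c N)"
  unfolding fourier_deriv_def[abs_def] by (intro continuous_intros)

lemma cis_add_int_2pi: "cis (x + of_int n * (2 * pi)) = cis x"
  by (simp add: complex_eq_iff sin_add cos_add mult.commute[of "of_int n" "2 * pi"])

lemma fourier_deriv_periodic:
  assumes "0 < L"
  shows "fourier_deriv L c N (y + 2 * L) = fourier_deriv L c N y"
proof -
  have "cis (of_int n * pi / L * (y + 2 * L)) = cis (of_int n * pi / L * y)" for n
    using cis_add_int_2pi[of "of_int n * pi / L * y" n] assms by (simp add: field_simps)
  then show ?thesis by (simp add: fourier_deriv_def)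
qed

lemma mode_eq_cis:
  "mode L v n x t = cis (of_int n * pi / L * ((1 - v) * (t + x))) - cis (of_int n * pi / L * ((1 + v) * (t - x)))"
proof -
  have "of_int n * pi * (1 - v) * (t + x) / L = of_int n * pi / L * ((1 - v) * (t + x))"
    "of_int n * pi * (1 + v) * (t - x) / L = of_int n * pi / L * ((1 + v) * (t - x))"
    by (simp_all add: mult.assoc)
  then show ?thesis unfolding mode_def cis_conv_exp by (simp only:)
qed

lemma sum_mode:
  "(\<Sum>n\<in>{- int N..int N} - {0}. c n * mode L v n x t) =
     fourier_sum L c N ((1 - v) * (t + x)) - fourier_sum L c N ((1 + v) * (t - x))"
  by (simp add: mode_eq_cis fourier_sum_def right_diff_distrib sum_subtractf)

lemma vector_derivative_mode:
  "vector_derivative (\<lambda>x. mode L v n x t) (at x) =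
     \<i> * complex_of_real (of_int n * pi / L * (1 - v)) * cis (of_int n * pi / L * ((1 - v) * (t + x))) +
     \<i> * complex_of_real (of_int n * pi / L * (1 + v)) * cis (of_int n * pi / L * ((1 + v) * (t - x)))"
proof (rule vector_derivative_at)
  define k where "k = of_int n * pi / L"
  have *: "(\<lambda>x. mode L v n x t) = (\<lambda>x. cis (k * (1 - v) * t + k * (1 - v) * x) -
      cis (k * (1 + v) * t + - k * (1 + v) * x))"
    unfolding mode_eq_cis k_def[symmetric] by (simp add: algebra_simps)
  show "((\<lambda>x. mode L v n x t) has_vector_derivative
     \<i> * complex_of_real (of_int n * pi / L * (1 - v)) * cis (of_int n * pi / L * ((1 - v) * (t + x))) +
     \<i> * complex_of_real (of_int n * pi / L * (1 + v)) * cis (of_int n * pi / L * ((1 + v) * (t - x)))) (at x)"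
    unfolding * k_def[symmetric]
    by (rule has_vector_derivative_eq_rhs[OF has_vector_derivative_diff[OF
          has_vector_derivative_cis_affine has_vector_derivative_cis_affine]])
      (simp add: algebra_simps)
qed

text \<open>At \<open>x = xb + vt\<close> the phases \<open>(1 - v)(t + x)\<close> and \<open>(1 + v)(t - x)\<close> differ by \<open>2 xb\<close>, which is 0 or
  the period \<open>2L\<close> of the profile. So the derivatives of the two
  waves add up, which produces the factor 2.\<close>
lemma sum_mode_derivative_at_endpoint:
  assumes L: "0 < L" and xb: "xb = 0 \<or> xb = L"
  shows "(\<Sum>n\<in>{- int N..int N} - {0}. c n * vector_derivative (\<lambda>x. mode L v n x t) (at (xb + v * t))) =
     2 * fourier_deriv L c N ((1 - v\<^sup>2) * t + (1 - v) * xb)"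
proof -
  have "vector_derivative (\<lambda>x. mode L v n x t) (at (xb + v * t)) =
      2 * (\<i> * complex_of_real (of_int n * pi / L) * cis (of_int n * pi / L * ((1 - v\<^sup>2) * t + (1 - v) * xb)))" for n
  proof -
    define k where "k = of_int n * pi / L"
    have 1: "k * ((1 - v) * (t + (xb + v * t))) = k * ((1 - v\<^sup>2) * t + (1 - v) * xb)"
      by (simp add: algebra_simps power2_eq_square)
    have "k * ((1 - v) * (t + (xb + v * t))) = k * ((1 + v) * (t - (xb + v * t))) + 2 * k * xb"
      by (simp add: algebra_simps)
    moreover have "cis (2 * k * xb) = 1"
      using xb L cis_add_int_2pi[of 0 n] by (auto simp: k_def mult_ac)
    ultimately have 2: "cis (k * ((1 - v) * (t + (xb + v * t)))) = cis (k * ((1 + v) * (t - (xb + v * t))))"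
      by (simp add: cis_mult[symmetric])
    show ?thesis unfolding vector_derivative_mode k_def[symmetric] 2[symmetric] 1
      by (simp add: algebra_simps)
  qed
  then show ?thesis by (simp add: fourier_deriv_def sum_distrib_left mult_ac)
qed

lemma has_sum_imp_symmetric_partial_sums:
  fixes f :: "int \<Rightarrow> complex"
  assumes "(f has_sum l) (UNIV - {0})"
  shows "(\<lambda>N. \<Sum>n\<in>{- int N..int N} - {0}. f n) \<longlonglongrightarrow> l"
proof -
  have "filterlim (\<lambda>N. {- int N..int N} - {0}) (finite_subsets_at_top (UNIV - {0})) sequentially"
  proof (rule filterlim_finite_subsets_at_top[THEN iffD2], intro allI impI)
    fix X :: "int set" assume X: "finite X \<and> X \<subseteq> UNIV - {0}"
    define K where "K = Max (abs ` X)"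
    have K: "\<bar>n\<bar> \<le> K" if "n \<in> X" for n using X that by (simp add: K_def)
    show "\<forall>\<^sub>F N in sequentially. finite ({- int N..int N} - {0}) \<and> X \<subseteq> {- int N..int N} - {0} \<and>
        {- int N..int N} - {0} \<subseteq> UNIV - {0}"
    proof (rule eventually_sequentiallyI[of "nat K"])
      fix N assume "nat K \<le> N"
      then have "n \<in> {- int N..int N}" if "n \<in> X" for n using K[OF that] by auto
      then show "finite ({- int N..int N} - {0}) \<and> X \<subseteq> {- int N..int N} - {0} \<and>
        {- int N..int N} - {0} \<subseteq> UNIV - {0}" using X by blast
    qed
  qed
  with assms show ?thesis unfolding has_sum_def by (rule filterlim_compose)
qed

text \<open>The trace is real valued, so taking real parts of the partial sums does not increase the distance
  to it.\<close>
lemma endpoint_trace_real: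
  assumes L: "0 < L" and xb: "xb = 0 \<or> xb = L" and T: "0 < T"
    and g: "g \<in> L2 0 T"
    and lim: "(\<lambda>N. \<integral>t. (cmod ((\<Sum>n\<in>{- int N..int N} - {0}.
                      c n * vector_derivative (\<lambda>x. mode L v n x t) (at (xb + v * t)))
                    - complex_of_real (g t)))\<^sup>2 \<partial>lebesgue_on {0<..<T}) \<longlonglongrightarrow> 0"
  shows "(\<lambda>N. L2_norm 0 T (\<lambda>t. 2 * Re (fourier_deriv L c N ((1 - v\<^sup>2) * t + (1 - v) * xb)) - g t)) \<longlonglongrightarrow> 0"
proof -
  define Z where "Z N t = 2 * fourier_deriv L c N ((1 - v\<^sup>2) * t + (1 - v) * xb)" for N t
  have cZ: "continuous_on S (Z N)" for S N
    unfolding Z_def[abs_def]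
    by (intro continuous_intros continuous_on_compose2[OF continuous_on_fourier_deriv[of UNIV]]) auto
  have R: "(\<lambda>t. Re (Z N t)) \<in> L2 0 T" and I: "(\<lambda>t. Im (Z N t)) \<in> L2 0 T" for N
    by (intro continuous_L2 continuous_intros cZ)+
  have cm: "(cmod (Z N t - complex_of_real (g t)))\<^sup>2 = (Re (Z N t) - g t)\<^sup>2 + (Im (Z N t))\<^sup>2" for N t
    by (simp add: cmod_power2)
  have le: "L2_norm 0 T (\<lambda>t. Re (Z N t) - g t) \<le>
      sqrt (\<integral>t. (cmod (Z N t - complex_of_real (g t)))\<^sup>2 \<partial>lebesgue_on {0<..<T})" for N
    unfolding L2_norm_def cm
    by (intro real_sqrt_le_mono integral_mono Bochner_Integration.integrable_add
        L2_integrable_square L2_diff R I g) auto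
  have "(\<lambda>N. sqrt (\<integral>t. (cmod (Z N t - complex_of_real (g t)))\<^sup>2 \<partial>lebesgue_on {0<..<T})) \<longlonglongrightarrow> sqrt 0"
    using lim unfolding sum_mode_derivative_at_endpoint[OF L xb] Z_def[symmetric]
    by (rule tendsto_real_sqrt)
  then have *: "(\<lambda>N. sqrt (\<integral>t. (cmod (Z N t - complex_of_real (g t)))\<^sup>2 \<partial>lebesgue_on {0<..<T})) \<longlonglongrightarrow> 0"
    by (simp only: real_sqrt_zero)
  have "(\<lambda>N. L2_norm 0 T (\<lambda>t. Re (Z N t) - g t)) \<longlonglongrightarrow> 0"
    by (rule Lim_null_comparison[OF always_eventually *])
      (simp only: real_norm_def abs_of_nonneg[OF L2_norm_nonneg] le simp_thms)
  then show ?thesis by (simp add: Z_def)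
qed

text \<open>What the rest of the proof uses of the series: \<open>r N\<close> are continuous functions of period \<open>2L\<close> with
  antiderivatives \<open>U N\<close>, they approximate the profile derivative \<open>f\<close> in \<open>L\<^sup>2\<close>, and the increments of \<open>U N\<close>
  give \<open>\<phi>\<close>. The intervals start at \<open>-2L\<close> because \<open>(1 + v)(t - x)\<close> stays above that value for \<open>t \<ge> 0\<close>
  and \<open>x\<close> in the moving interval.\<close>
definition wave_profile ::
  "real \<Rightarrow> real \<Rightarrow> (real \<Rightarrow> real \<Rightarrow> real) \<Rightarrow> (nat \<Rightarrow> real \<Rightarrow> real) \<Rightarrow> (nat \<Rightarrow> real \<Rightarrow> real) \<Rightarrow> (real \<Rightarrow> real) \<Rightarrow> bool" where
  "wave_profile L v \<phi> U r f \<longleftrightarrow>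
     (\<forall>N y. (U N has_real_derivative r N y) (at y)) \<and>
     (\<forall>N. continuous_on UNIV (r N)) \<and>
     (\<forall>N y. r N (y + 2 * L) = r N y) \<and>
     (\<forall>R. f \<in> L2 (- 2 * L) R \<and> (\<lambda>N. L2_norm (- 2 * L) R (\<lambda>y. r N y - f y)) \<longlonglongrightarrow> 0) \<and>
     (\<forall>t\<ge>0. AE x in lebesgue_on {v * t<..<L + v * t}.
        (\<lambda>N. U N ((1 - v) * (t + x)) - U N ((1 + v) * (t - x))) \<longlonglongrightarrow> \<phi> x t)"

lemma one_minus_square_pos: "0 < v \<Longrightarrow> v < 1 \<Longrightarrow> 0 < 1 - v\<^sup>2" for v :: real
  by (simp add: power_less_one_iff abs_square_less_1)

text \<open>The trace already contains the limit of the differentiated series: solving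
  \<open>g t = 2 f((1 - v\<^sup>2)t + (1 - v)xb)\<close> for \<open>f\<close> defines the profile, and its \<open>L\<^sup>2\<close> approximation is
  that of the trace after an affine substitution.\<close>
lemma endpoint_trace_imp_profile:
  assumes L: "0 < L" and v: "0 < v" "v < 1" and xb: "xb = 0 \<or> xb = L"
    and trace: "endpoint_trace L v xb \<phi> g"
  obtains U r f where "wave_profile L v \<phi> U r f"
    "\<And>T. 0 < T \<Longrightarrow> g \<in> L2 0 T"
    "\<And>T. 0 < T \<Longrightarrow> (\<lambda>N. L2_norm 0 T (\<lambda>t. 2 * r N ((1 - v\<^sup>2) * t + (1 - v) * xb) - g t)) \<longlonglongrightarrow> 0"
proof -
  obtain c where c: "series_representation L v \<phi> c" and
    tr: "\<And>T. 0 < T \<Longrightarrow> g \<in> L2 0 T \<and>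
           (\<lambda>N. \<integral>t. (cmod ((\<Sum>n\<in>{- int N..int N} - {0}.
                      c n * vector_derivative (\<lambda>x. mode L v n x t) (at (xb + v * t)))
                    - complex_of_real (g t)))\<^sup>2 \<partial>lebesgue_on {0<..<T}) \<longlonglongrightarrow> 0"
    using trace unfolding endpoint_trace_def by blast
  define U where "U N y = Re (fourier_sum L c N y)" for N y
  define r where "r N y = Re (fourier_deriv L c N y)" for N y
  define s where "s = (1 - v) * xb"
  \<comment> \<open>The trace is given for positive times only; shifting by two periods makes the argument positive
    for all \<open>y > -2L\<close>.\<close>
  define f where "f y = g ((y + 4 * L - s) / (1 - v\<^sup>2)) / 2" for y
  have v2: "0 < 1 - v\<^sup>2" using v by (rule one_minus_square_pos)
  have s: "0 \<le> s" "s \<le> L" using xb v L by (auto simp: s_def mult_left_le_one_le)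
  have g: "g \<in> L2 0 T" if "0 < T" for T using tr[OF that] by blast
  have lim: "(\<lambda>N. L2_norm 0 T (\<lambda>t. 2 * r N ((1 - v\<^sup>2) * t + s) - g t)) \<longlonglongrightarrow> 0" if "0 < T" for T
    using endpoint_trace_real[OF L xb that g[OF that]] tr[OF that] by (simp add: r_def s_def)
  have cr: "continuous_on S (r N)" for S N
    unfolding r_def[abs_def] by (intro continuous_intros continuous_on_fourier_deriv)
  have per: "r N (y + 2 * L) = r N y" for N y
    by (simp add: r_def fourier_deriv_periodic[OF L])
  then have per2: "r N (y + 4 * L) = r N y" for N y
    using per[of N y] per[of N "y + 2 * L"] by (simp add: algebra_simps)
  have f: "f \<in> L2 (- 2 * L) R \<and> (\<lambda>N. L2_norm (- 2 * L) R (\<lambda>y. r N y - f y)) \<longlonglongrightarrow> 0" for R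
  proof -
    define T where "T = max 1 ((R + 4 * L) / (1 - v\<^sup>2))"
    define a b where "a = (4 * L - s) / (1 - v\<^sup>2)" and "b = 1 / (1 - v\<^sup>2)"
    have T: "0 < T" by (simp add: T_def)
    have b: "b \<noteq> 0" "0 < b" using v2 by (auto simp: b_def)
    have ab: "a + b * y = (y + 4 * L - s) / (1 - v\<^sup>2)" for y
      by (simp add: a_def b_def add_divide_distrib diff_divide_distrib)
    have sub: "a + b * y \<in> {0<..<T}" if "y \<in> {- 2 * L<..<R}" for y
    proof -
      have "0 < y + 4 * L - s" "y + 4 * L - s < R + 4 * L" using that s L by auto
      then have "0 < a + b * y" "a + b * y < (R + 4 * L) / (1 - v\<^sup>2)"
        unfolding ab using v2 by (auto intro: divide_strict_right_mono)
      then show ?thesis by (auto simp: T_def)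
    qed
    have "(\<lambda>y. g (a + b * y)) \<in> L2 (- 2 * L) R"
      by (rule L2_affine(1)[OF g[OF T] b(1) sub])
    from L2_cmult[OF this, of "1 / 2"] have fL: "f \<in> L2 (- 2 * L) R"
      by (simp add: ab f_def[abs_def])
    have hL: "(\<lambda>t. 2 * r N ((1 - v\<^sup>2) * t + s) - g t) \<in> L2 0 T" for N
      by (intro L2_diff L2_cmult g T continuous_L2
          continuous_on_compose2[OF cr[of UNIV N]] continuous_intros) auto
    have rf: "2 * r N ((1 - v\<^sup>2) * (a + b * y) + s) - g (a + b * y) = 2 * (r N y - f y)" for N y
      unfolding ab f_def using v2 by (simp add: per2)
    have "L2_norm (- 2 * L) R (\<lambda>y. r N y - f y) \<le>
        L2_norm 0 T (\<lambda>t. 2 * r N ((1 - v\<^sup>2) * t + s) - g t) * (1 / (2 * sqrt \<bar>b\<bar>))" for N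
      using L2_affine(2)[where a = "- 2 * L" and b = R and t = a, OF hL[of N] b(1) sub] unfolding rf L2_norm_cmult by (simp add: field_simps)
    then have "(\<lambda>N. L2_norm (- 2 * L) R (\<lambda>y. r N y - f y)) \<longlonglongrightarrow> 0"
      by (intro Lim_null_comparison[OF always_eventually
            tendsto_mult_left_zero[OF lim[OF T], of "1 / (2 * sqrt \<bar>b\<bar>)"]]) auto
    then show ?thesis using fL by blast
  qed
  have ae: "AE x in lebesgue_on {v * t<..<L + v * t}.
        (\<lambda>N. U N ((1 - v) * (t + x)) - U N ((1 + v) * (t - x))) \<longlonglongrightarrow> \<phi> x t" if "0 \<le> t" for t
  proof -
    have "AE x in lebesgue_on {v * t<..<L + v * t}.
        ((\<lambda>n. c n * mode L v n x t) has_sum complex_of_real (\<phi> x t)) (UNIV - {0})"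
      using c that by (auto simp: series_representation_def)
    then show ?thesis
    proof eventually_elim
      case (elim x)
      from tendsto_Re[OF has_sum_imp_symmetric_partial_sums[OF elim]]
      show ?case by (simp add: sum_mode U_def)
    qed
  qed
  have "wave_profile L v \<phi> U r f"
    unfolding wave_profile_def
    using cr per f ae Re_fourier_sum_has_derivative[of L c] by (simp add: U_def[abs_def] r_def[abs_def])
  then show ?thesis using that g lim by (simp add: s_def)
qed

section \<open>The derivatives of the solution at time zero\<close>

lemma increment_le_L2_norm:
  assumes h: "\<And>y. (h has_real_derivative h' y) (at y)" and c: "continuous_on UNIV h'"
    and ab: "p \<le> a" "a \<le> b" "b \<le> q"
  shows "\<bar>h b - h a\<bar> \<le> L2_norm p q h' * sqrt (q - p)"
proof -
  have ch: "continuous_on S h'" for S using c continuous_on_subset by blast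
  have h'L: "h' \<in> L2 x y" and 1: "(\<lambda>_. 1) \<in> L2 x y" for x y by (intro continuous_L2 ch continuous_on_const)+
  have "(h' has_integral h b - h a) {a..b}"
    by (rule fundamental_theorem_of_calculus)
      (use ab h in \<open>auto simp: has_real_derivative_iff_has_vector_derivative[symmetric]
        intro: has_field_derivative_at_within\<close>)
  then have "h b - h a = (\<integral>y. h' y * 1 \<partial>lebesgue_on {a<..<b})"
    by (simp add: continuous_integral_Ioo[OF ch] integral_unique)
  then have "\<bar>h b - h a\<bar> \<le> L2_norm a b h' * L2_norm a b (\<lambda>_. 1)"
    using L2_Cauchy_Schwarz[OF h'L 1] by metis
  also have "\<dots> \<le> L2_norm p q h' * sqrt (q - p)"
    by (intro mult_mono L2_norm_subset_mono h'L) (use ab in \<open>auto simp: L2_norm_const_1\<close>)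
  finally show ?thesis .
qed

lemma increment_le_L2_norm_sym:
  assumes "\<And>y. (h has_real_derivative h' y) (at y)" "continuous_on UNIV h'"
    and "a \<in> {p..q}" "b \<in> {p..q}"
  shows "\<bar>h b - h a\<bar> \<le> L2_norm p q h' * sqrt (q - p)"
  using increment_le_L2_norm[OF assms(1,2), of p a b q] increment_le_L2_norm[OF assms(1,2), of p b a q] assms(3,4)
  by (cases "a \<le> b") (auto simp: abs_minus_commute)

text \<open>The bound does not depend on \<open>a\<close> and \<open>b\<close>: comparing the increments of \<open>U N\<close> and \<open>U K\<close> by
  Cauchy-Schwarz and letting \<open>K\<close> tend to infinity turns pointwise convergence into a uniform rate.\<close>
lemma increments_converge_uniformly:
  assumes U: "\<And>N y. (U N has_real_derivative r N y) (at y)" and r: "\<And>N. continuous_on UNIV (r N)"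
    and f: "f \<in> L2 p q" and lim: "(\<lambda>N. L2_norm p q (\<lambda>y. r N y - f y)) \<longlonglongrightarrow> 0"
    and ab: "a \<in> {p..q}" "b \<in> {p..q}" and l: "(\<lambda>N. U N b - U N a) \<longlonglongrightarrow> l"
  shows "\<bar>U N b - U N a - l\<bar> \<le> L2_norm p q (\<lambda>y. r N y - f y) * sqrt (q - p)"
proof -
  define e where "e N = L2_norm p q (\<lambda>y. r N y - f y)" for N
  have rL: "r N \<in> L2 p q" for N by (intro continuous_L2) (meson r continuous_on_subset subset_UNIV)
  have "\<bar>(U N b - U N a) - (U K b - U K a)\<bar> \<le> (e N + e K) * sqrt (q - p)" for K
  proof -
    have "\<bar>(U N b - U K b) - (U N a - U K a)\<bar> \<le> L2_norm p q (\<lambda>y. r N y - r K y) * sqrt (q - p)"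
      by (rule increment_le_L2_norm_sym[where h = "\<lambda>y. U N y - U K y"])
        (use ab in \<open>auto intro!: DERIV_diff U continuous_on_diff r\<close>)
    also have "\<dots> = L2_norm p q (\<lambda>y. (r N y - f y) + (f y - r K y)) * sqrt (q - p)"
      by simp
    also have "\<dots> \<le> (e N + e K) * sqrt (q - p)"
      using L2_norm_triangle[OF L2_diff[OF rL[of N] f] L2_diff[OF f rL[of K]]] ab
      by (intro mult_right_mono) (auto simp: e_def L2_norm_minus_commute[of p q f])
    finally show ?thesis by (simp add: algebra_simps)
  qed
  moreover have "(\<lambda>K. \<bar>(U N b - U N a) - (U K b - U K a)\<bar>) \<longlonglongrightarrow> \<bar>(U N b - U N a) - l\<bar>"
    by (intro tendsto_intros l)
  moreover have "(\<lambda>K. (e N + e K) * sqrt (q - p)) \<longlonglongrightarrow> (e N + 0) * sqrt (q - p)"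
    using lim unfolding e_def[symmetric] by (intro tendsto_intros)
  ultimately show ?thesis unfolding e_def[symmetric] by (auto intro: LIMSEQ_le)
qed

text \<open>The partial sums \<open>\<Phi> N\<close> are classical waves with time derivative \<open>\<Psi> N\<close> and space derivative \<open>X N\<close>.
  All three converge in \<open>L\<^sup>2\<close> of the moving interval, at a rate \<open>E N\<close> that is uniform in
  \<open>0 \<le> t \<le> L\<close>, to \<open>\<phi>\<close> and to the expressions \<open>\<psi>\<close> and \<open>\<xi>\<close> in the profile; so these are the derivatives
  of \<open>\<phi>\<close> at time 0.\<close>
lemma weak_solution_initial_derivatives:
  assumes L: "0 < L" and v: "0 < v" "v < 1"
    and sol: "weak_solution L v \<phi>0 \<phi>1 \<phi> \<phi>x \<phi>t" and prof: "wave_profile L v \<phi> U r f"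
  shows "AE x in lebesgue_on {0<..<L}. \<phi>x x 0 = (1 - v) * f ((1 - v) * x) + (1 + v) * f (- ((1 + v) * x))"
    and "AE x in lebesgue_on {0<..<L}. \<phi>t x 0 = (1 - v) * f ((1 - v) * x) - (1 + v) * f (- ((1 + v) * x))"
proof -
  have U: "\<And>N y. (U N has_real_derivative r N y) (at y)" and r: "\<And>N. continuous_on UNIV (r N)"
    and f: "\<And>R. f \<in> L2 (- 2 * L) R" and lim: "\<And>R. (\<lambda>N. L2_norm (- 2 * L) R (\<lambda>y. r N y - f y)) \<longlonglongrightarrow> 0"
    and ae: "\<And>t. 0 \<le> t \<Longrightarrow> AE x in lebesgue_on {v * t<..<L + v * t}.
        (\<lambda>N. U N ((1 - v) * (t + x)) - U N ((1 + v) * (t - x))) \<longlonglongrightarrow> \<phi> x t"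
    using prof unfolding wave_profile_def by auto
  define e where "e N = L2_norm (- 2 * L) (4 * L) (\<lambda>y. r N y - f y)" for N
  have e0: "0 \<le> e N" for N by (simp add: e_def)
  define \<Phi> where "\<Phi> N x t = U N ((1 - v) * (t + x)) - U N ((1 + v) * (t - x))" for N x t
  define \<Psi> where "\<Psi> N x t = (1 - v) * r N ((1 - v) * (t + x)) - (1 + v) * r N ((1 + v) * (t - x))" for N x t
  define \<psi> where "\<psi> x t = (1 - v) * f ((1 - v) * (t + x)) - (1 + v) * f ((1 + v) * (t - x))" for x t
  define X where "X N x t = (1 - v) * r N ((1 - v) * (t + x)) + (1 + v) * r N ((1 + v) * (t - x))" for N x t
  define \<xi> where "\<xi> x t = (1 - v) * f ((1 - v) * (t + x)) + (1 + v) * f ((1 + v) * (t - x))" for x t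
  \<comment> \<open>The first term bounds \<open>\<Phi> N - \<phi>\<close> (\<open>6L\<close> is the length of the interval \<open>(-2L,4L)\<close> in which all
    arguments lie, \<open>L\<close> that of the moving interval), the others come from substituting in the two waves.\<close>
  define K where "K = sqrt (6 * L) * sqrt L + (1 - v) / sqrt (1 - v) + (1 + v) / sqrt (1 + v)"
  define E where "E N = K * e N" for N
  have E: "E \<longlonglongrightarrow> 0" unfolding E_def e_def using tendsto_mult_left[OF lim[of "4 * L"], of K] by simp
  have range: "(1 - v) * (t + x) \<in> {- 2 * L<..<4 * L}" "(1 + v) * (t - x) \<in> {- 2 * L<..<4 * L}"
    if t: "0 \<le> t" "t \<le> L" and x: "x \<in> {v * t<..<L + v * t}" for x t
  proof -
    have vt: "0 \<le> v * t" "v * t \<le> L" using t v mult_mono[of v 1 t L] L by auto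
    have "0 < t + x" "t + x < 3 * L" using t x vt by auto
    then have "0 < (1 - v) * (t + x)" "(1 - v) * (t + x) \<le> 1 * (t + x)"
      using v by (simp, intro mult_right_mono) auto
    then show "(1 - v) * (t + x) \<in> {- 2 * L<..<4 * L}" using \<open>t + x < 3 * L\<close> L by auto
    have "v * t \<le> t" using t v mult_right_mono[of v 1 t] by simp
    then have "t - x < L" "- L < t - x" using t x vt by auto
    then have "\<bar>(1 + v) * (t - x)\<bar> < 2 * L"
      unfolding abs_mult using v by (intro mult_strict_mono) auto
    then show "(1 + v) * (t - x) \<in> {- 2 * L<..<4 * L}" using L by auto
  qed
  \<comment> \<open>With \<open>\<sigma> = -1\<close> this bounds the time derivatives, with \<open>\<sigma> = 1\<close> the space derivatives.\<close>
  have comb: "(\<lambda>x. (1 - v) * h ((1 - v) * (t + x)) + \<sigma> * ((1 + v) * h ((1 + v) * (t - x)))) \<in> L2 (v * t) (L + v * t)"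
    "L2_norm (v * t) (L + v * t) (\<lambda>x. (1 - v) * h ((1 - v) * (t + x)) + \<sigma> * ((1 + v) * h ((1 + v) * (t - x))))
      \<le> ((1 - v) / sqrt (1 - v) + (1 + v) / sqrt (1 + v)) * L2_norm (- 2 * L) (4 * L) h"
    if h: "h \<in> L2 (- 2 * L) (4 * L)" and t: "0 \<le> t" "t \<le> L" and \<sigma>: "\<bar>\<sigma>\<bar> = 1" for h t \<sigma>
  proof -
    have e1: "(1 - v) * t + (1 - v) * x = (1 - v) * (t + x)" "(1 + v) * t + - (1 + v) * x = (1 + v) * (t - x)" for x
      by (simp_all add: algebra_simps)
    have 1: "(\<lambda>x. h ((1 - v) * (t + x))) \<in> L2 (v * t) (L + v * t)"
      "L2_norm (v * t) (L + v * t) (\<lambda>x. h ((1 - v) * (t + x))) \<le> L2_norm (- 2 * L) (4 * L) h / sqrt \<bar>1 - v\<bar>"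
      using L2_affine[OF h, where c = "1 - v" and t = "(1 - v) * t" and a = "v * t" and b = "L + v * t"]
        v range(1)[OF t] unfolding e1 by auto
    have 2: "(\<lambda>x. h ((1 + v) * (t - x))) \<in> L2 (v * t) (L + v * t)"
      "L2_norm (v * t) (L + v * t) (\<lambda>x. h ((1 + v) * (t - x))) \<le> L2_norm (- 2 * L) (4 * L) h / sqrt \<bar>- (1 + v)\<bar>"
      using L2_affine[OF h, where c = "- (1 + v)" and t = "(1 + v) * t" and a = "v * t" and b = "L + v * t"]
        v range(2)[OF t] unfolding e1 by auto
    show "(\<lambda>x. (1 - v) * h ((1 - v) * (t + x)) + \<sigma> * ((1 + v) * h ((1 + v) * (t - x)))) \<in> L2 (v * t) (L + v * t)"
      by (intro L2_add L2_cmult 1 2)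
    have "L2_norm (v * t) (L + v * t) (\<lambda>x. (1 - v) * h ((1 - v) * (t + x)) + \<sigma> * ((1 + v) * h ((1 + v) * (t - x))))
      \<le> \<bar>1 - v\<bar> * L2_norm (v * t) (L + v * t) (\<lambda>x. h ((1 - v) * (t + x)))
        + \<bar>\<sigma>\<bar> * (\<bar>1 + v\<bar> * L2_norm (v * t) (L + v * t) (\<lambda>x. h ((1 + v) * (t - x))))"
      unfolding L2_norm_cmult[symmetric] by (intro L2_norm_triangle L2_cmult 1 2)
    also have "\<dots> \<le> (1 - v) * (L2_norm (- 2 * L) (4 * L) h / sqrt (1 - v)) +
        (1 + v) * (L2_norm (- 2 * L) (4 * L) h / sqrt (1 + v))"
    proof -
      have "L2_norm (v * t) (L + v * t) (\<lambda>x. h ((1 - v) * (t + x))) \<le> L2_norm (- 2 * L) (4 * L) h / sqrt (1 - v)"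
        "L2_norm (v * t) (L + v * t) (\<lambda>x. h ((1 + v) * (t - x))) \<le> L2_norm (- 2 * L) (4 * L) h / sqrt (1 + v)"
        using 1(2) 2(2) v by (simp_all add: add.commute)
      then have "(1 - v) * L2_norm (v * t) (L + v * t) (\<lambda>x. h ((1 - v) * (t + x))) \<le>
          (1 - v) * (L2_norm (- 2 * L) (4 * L) h / sqrt (1 - v))"
        "(1 + v) * L2_norm (v * t) (L + v * t) (\<lambda>x. h ((1 + v) * (t - x))) \<le>
          (1 + v) * (L2_norm (- 2 * L) (4 * L) h / sqrt (1 + v))"
        using v by (intro mult_left_mono; simp)+
      moreover have "\<bar>1 - v\<bar> = 1 - v" "\<bar>1 + v\<bar> = 1 + v" using v by auto
      ultimately show ?thesis unfolding \<sigma> by simp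
    qed
    finally show "L2_norm (v * t) (L + v * t) (\<lambda>x. (1 - v) * h ((1 - v) * (t + x)) + \<sigma> * ((1 + v) * h ((1 + v) * (t - x))))
      \<le> ((1 - v) / sqrt (1 - v) + (1 + v) / sqrt (1 + v)) * L2_norm (- 2 * L) (4 * L) h"
      by (simp add: algebra_simps)
  qed
  have rL: "r N \<in> L2 p q" for N p q by (intro continuous_L2) (meson r continuous_on_subset subset_UNIV)
  have K: "((1 - v) / sqrt (1 - v) + (1 + v) / sqrt (1 + v)) * e N \<le> E N" for N
    unfolding E_def K_def using e0[of N] L by (intro mult_right_mono) auto
  have \<psi>L: "(\<lambda>x. \<psi> x t) \<in> L2 (v * t) (L + v * t)" if "0 \<le> t" "t \<le> L" for t
    using comb(1)[OF f that, of "-1"] by (simp add: \<psi>_def)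
  have \<xi>L: "(\<lambda>x. \<xi> x t) \<in> L2 (v * t) (L + v * t)" if "0 \<le> t" "t \<le> L" for t
    using comb(1)[OF f that, of 1] by (simp add: \<xi>_def)
  have \<Psi>lim: "L2_norm (v * t) (L + v * t) (\<lambda>x. \<Psi> N x t - \<psi> x t) \<le> E N" if "0 \<le> t" "t \<le> L" for t N
    using comb(2)[OF L2_diff[OF rL[of N] f] that, of "-1"] K[of N]
    by (simp add: \<Psi>_def \<psi>_def e_def algebra_simps)
  have Xlim: "L2_norm (v * t) (L + v * t) (\<lambda>x. X N x t - \<xi> x t) \<le> E N" if "0 \<le> t" "t \<le> L" for t N
    using comb(2)[OF L2_diff[OF rL[of N] f] that, of 1] K[of N]
    by (simp add: X_def \<xi>_def e_def algebra_simps)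
  have c\<Psi>: "continuous_on UNIV (\<lambda>(t, x). \<Psi> N x t)" for N
    unfolding \<Psi>_def case_prod_unfold
    by (intro continuous_intros continuous_on_compose2[OF r[of N]]) auto
  have cU: "continuous_on S (U N)" for N S
    by (meson DERIV_isCont U continuous_at_imp_continuous_on)
  have c\<Phi>: "continuous_on UNIV (\<lambda>(t, x). \<Phi> N x t)" for N
    unfolding \<Phi>_def case_prod_unfold
    by (intro continuous_intros continuous_on_compose2[OF cU[of UNIV N]]) auto
  have dt: "(\<Phi> N x has_real_derivative \<Psi> N x t) (at t)" for N x t
    unfolding \<Phi>_def[abs_def] \<Psi>_def
    by (auto intro!: derivative_eq_intros DERIV_chain2[OF U] simp: algebra_simps)
  have dx: "((\<lambda>x. \<Phi> N x 0) has_real_derivative X N x 0) (at x)" for N x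
    unfolding \<Phi>_def[abs_def] X_def
    by (auto intro!: derivative_eq_intros DERIV_chain2[OF U] simp: algebra_simps)
  have CH: "C_H10 L v L \<phi> \<phi>x" using sol L by (auto simp: weak_solution_def)
  have \<phi>L: "(\<lambda>x. \<phi> x t) \<in> L2 (v * t) (L + v * t)" if "0 \<le> t" "t \<le> L" for t
    using CH that by (auto simp: C_H10_def C_L2_def)
  have \<Phi>lim: "L2_norm (v * t) (L + v * t) (\<lambda>x. \<Phi> N x t - \<phi> x t) \<le> E N" if t: "0 \<le> t" "t \<le> L" for t N
  proof -
    have "AE x in lebesgue_on {v * t<..<L + v * t}. \<bar>\<Phi> N x t - \<phi> x t\<bar> \<le> e N * sqrt (6 * L)"
    proof (rule AE_mp[OF ae[OF t(1)]], rule AE_I2, rule impI)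
      fix x assume "x \<in> space (lebesgue_on {v * t<..<L + v * t})"
        and l: "(\<lambda>N. U N ((1 - v) * (t + x)) - U N ((1 + v) * (t - x))) \<longlonglongrightarrow> \<phi> x t"
      then have x: "x \<in> {v * t<..<L + v * t}" by simp
      have "\<bar>\<Phi> N x t - \<phi> x t\<bar> \<le> L2_norm (- 2 * L) (4 * L) (\<lambda>y. r N y - f y) * sqrt (4 * L - - 2 * L)"
        unfolding \<Phi>_def
        by (rule increments_converge_uniformly[OF U r f lim _ _ l]) (use range[OF t x] in auto)
      then show "\<bar>\<Phi> N x t - \<phi> x t\<bar> \<le> e N * sqrt (6 * L)" by (simp add: e_def)
    qed
    moreover have "(\<lambda>x. \<Phi> N x t - \<phi> x t) \<in> L2 (v * t) (L + v * t)"
      using continuous_on_compose2[OF c\<Phi>[of N], of "{v * t..L + v * t}" "\<lambda>x. (t, x)"]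
      by (intro L2_diff \<phi>L t continuous_L2) (simp add: continuous_intros)
    ultimately have "L2_norm (v * t) (L + v * t) (\<lambda>x. \<Phi> N x t - \<phi> x t) \<le> (e N * sqrt (6 * L)) * sqrt (L + v * t - v * t)"
      by (intro L2_norm_bounded(2) L2_measurable) (use e0 L in auto)
    also have "\<dots> = sqrt (6 * L) * sqrt L * e N" by simp
    also have "\<dots> \<le> E N"
      unfolding E_def K_def using e0[of N] v by (intro mult_right_mono) auto
    finally show ?thesis .
  qed
  have "AE x in lebesgue_on {0<..<L}. \<phi>t x 0 = \<psi> x 0"
    by (rule time_derivative_at_0_of_limit[OF sol L v(1) L dt c\<Phi> c\<Psi> E \<Phi>lim \<psi>L \<Psi>lim])
  then show "AE x in lebesgue_on {0<..<L}. \<phi>t x 0 = (1 - v) * f ((1 - v) * x) - (1 + v) * f (- ((1 + v) * x))"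
    by (simp add: \<psi>_def)
  have w: "has_weak_derivative 0 L (\<lambda>x. \<phi> x 0) (\<lambda>x. \<phi>x x 0)"
    using CH L by (force simp: C_H10_def)
  have "AE x in lebesgue_on {0<..<L}. \<phi>x x 0 = \<xi> x 0"
  proof (rule weak_derivative_of_limit[where W = "\<lambda>N x. \<Phi> N x 0" and D = "\<lambda>N x. X N x 0"])
    show "continuous_on UNIV (\<lambda>x. X N x 0)" for N
      unfolding X_def by (intro continuous_intros continuous_on_compose2[OF r[of N]]) auto
    show "(\<lambda>N. L2_norm 0 L (\<lambda>x. \<Phi> N x 0 - \<phi> x 0)) \<longlonglongrightarrow> 0"
      by (rule Lim_null_comparison[OF always_eventually E]) (use \<Phi>lim[of 0] L in simp)
    show "(\<lambda>N. L2_norm 0 L (\<lambda>x. X N x 0 - \<xi> x 0)) \<longlonglongrightarrow> 0"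
      by (rule Lim_null_comparison[OF always_eventually E]) (use Xlim[of 0] L in simp)
    show "(\<lambda>x. \<xi> x 0) \<in> L2 0 L" using \<xi>L[of 0] L by simp
    show "(\<integral>x. \<phi> x 0 * deriv (bump k c d) x \<partial>lebesgue_on {0<..<L}) =
      - (\<integral>x. \<phi>x x 0 * bump k c d x \<partial>lebesgue_on {0<..<L})" if "0 < c" "c < d" "d < L" for k c d
      using w bump_test_function[of 0 c d L k] that by (auto simp: has_weak_derivative_def)
  qed (use w dx in \<open>auto simp: has_weak_derivative_def\<close>)
  then show "AE x in lebesgue_on {0<..<L}. \<phi>x x 0 = (1 - v) * f ((1 - v) * x) + (1 + v) * f (- ((1 + v) * x))"
    by (simp add: \<xi>_def)
qed

section \<open>Energy and trace as integrals over a period\<close>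

lemma integral_lebesgue_on_split:
  fixes h :: "real \<Rightarrow> real"
  assumes h: "integrable (lebesgue_on {a<..<b}) h" and c: "a \<le> c" "c \<le> b"
  shows "(\<integral>x. h x \<partial>lebesgue_on {a<..<b}) = (\<integral>x. h x \<partial>lebesgue_on {a<..<c}) + (\<integral>x. h x \<partial>lebesgue_on {c<..<b})"
proof -
  have eq: "(\<integral>x. h x \<partial>lebesgue_on {p<..<q}) = integral {p..q} h" and "h integrable_on {p..q}"
    if "a \<le> p" "q \<le> b" for p q
  proof -
    have "integrable (lebesgue_on {p<..<q}) h"
      by (rule integrable_lebesgue_on_subset[OF h]) (use that in auto)
    then have i: "integrable (lebesgue_on {p..q}) h" by (simp add: integrable_lebesgue_on_Ioo_iff)
    show "(\<integral>x. h x \<partial>lebesgue_on {p<..<q}) = integral {p..q} h"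
      using i by (simp add: integral_lebesgue_on_Ioo lebesgue_integral_eq_integral)
    show "h integrable_on {p..q}" using i by (simp add: integrable_on_lebesgue_on)
  qed
  then show ?thesis
    using c Henstock_Kurzweil_Integration.integral_combine[of a c b h] by simp
qed

lemma integral_periodic:
  fixes h :: "real \<Rightarrow> real"
  assumes c: "continuous_on UNIV h" and per: "\<And>y. h (y + P) = h y" and P: "0 \<le> P" and ba: "b \<le> a"
  shows "(\<integral>x. h x \<partial>lebesgue_on {a<..<a + real M * P}) = real M * (\<integral>x. h x \<partial>lebesgue_on {b<..<b + P})"
proof -
  define J where "J p q = (\<integral>x. h x \<partial>lebesgue_on {p<..<q})" for p q
  have int: "integrable (lebesgue_on {p<..<q}) h" for p q
    by (intro continuous_integrable_Ioo continuous_on_subset[OF c]) auto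
  have split: "J p q = J p m + J m q" if "p \<le> m" "m \<le> q" for p m q
    unfolding J_def by (rule integral_lebesgue_on_split[OF int that])
  have shift: "J (p + P) (q + P) = J p q" for p q
    using lebesgue_on_affine(2)[of 1 "{p<..<q}" "{p + P<..<q + P}" P h]
    by (simp add: J_def per add.commute[of P])
  have period: "J p (p + P) = J b (b + P)" if "b \<le> p" for p
    using split[of b "b + P" "p + P"] split[of b p "p + P"] shift[of b p] that P by simp
  have "J a (a + real M * P) = real M * J b (b + P)"
  proof (induction M)
    case 0
    show ?case by (simp add: J_def)
  next
    case (Suc M)
    have "J a (a + real (Suc M) * P) = J a (a + real M * P) + J (a + real M * P) (a + real M * P + P)"
      using split[of a "a + real M * P" "a + real M * P + P"] P by (simp add: algebra_simps)
    also have "J (a + real M * P) (a + real M * P + P) = J b (b + P)"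
      by (rule period) (use ba P in \<open>simp add: add_increasing2\<close>)
    finally show ?case using Suc by (simp add: algebra_simps)
  qed
  then show ?thesis by (simp add: J_def)
qed

lemma L2_norm_tendsto:
  assumes F: "\<And>N. F N \<in> L2 a b" and f: "f \<in> L2 a b"
    and lim: "(\<lambda>N. L2_norm a b (\<lambda>x. F N x - f x)) \<longlonglongrightarrow> 0"
  shows "(\<lambda>N. L2_norm a b (F N)) \<longlonglongrightarrow> L2_norm a b f"
proof (rule LIM_zero_cancel, rule Lim_null_comparison[OF always_eventually lim], rule allI)
  fix N
  have "L2_norm a b (F N) \<le> L2_norm a b (\<lambda>x. F N x - f x) + L2_norm a b f"
    using L2_norm_triangle[OF L2_diff[OF F[of N] f] f] by simp
  moreover have "L2_norm a b f \<le> L2_norm a b (\<lambda>x. f x - F N x) + L2_norm a b (F N)"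
    using L2_norm_triangle[OF L2_diff[OF f F[of N]] F[of N]] by simp
  ultimately show "norm (L2_norm a b (F N) - L2_norm a b f) \<le> L2_norm a b (\<lambda>x. F N x - f x)"
    by (simp add: L2_norm_minus_commute[of a b f])
qed

text \<open>With \<open>\<phi>\<^sub>x = a + b\<close> and \<open>\<phi>\<^sub>t = a - b\<close> the energy density is diagonal in \<open>a\<close> and \<open>b\<close>, and the two
  substitutions map \<open>(0,L)\<close> onto adjacent intervals of total length \<open>2L\<close>.\<close>
lemma energy_eq_profile_norm:
  assumes L: "0 < L" and v: "0 < v" "v < 1" and f: "f \<in> L2 (- 2 * L) (2 * L)"
    and mx: "(\<lambda>x. \<phi>x x 0) \<in> L2 0 L" and mt: "(\<lambda>x. \<phi>t x 0) \<in> L2 0 L"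
    and x: "AE x in lebesgue_on {0<..<L}. \<phi>x x 0 = (1 - v) * f ((1 - v) * x) + (1 + v) * f (- ((1 + v) * x))"
    and t: "AE x in lebesgue_on {0<..<L}. \<phi>t x 0 = (1 - v) * f ((1 - v) * x) - (1 + v) * f (- ((1 + v) * x))"
  shows "energy L v \<phi>x \<phi>t 0 = (1 - v\<^sup>2) * (\<integral>y. (f y)\<^sup>2 \<partial>lebesgue_on {- (1 + v) * L<..<(1 - v) * L})"
proof -
  let ?M = "lebesgue_on {0<..<L}"
  have vL: "(1 + v) * L \<le> 2 * L" "(1 - v) * L \<le> 2 * L" "0 < (1 + v) * L" "0 < (1 - v) * L"
    using v L by (auto intro!: mult_right_mono)
  have vL': "- 2 * L \<le> - (1 + v) * L" "- (1 + v) * L \<le> 0"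
    using vL by (simp_all add: algebra_simps)
  have fi: "integrable (lebesgue_on {p<..<q}) (\<lambda>y. (f y)\<^sup>2)" if "- 2 * L \<le> p" "q \<le> 2 * L" for p q
    by (rule integrable_lebesgue_on_subset[OF L2_integrable_square[OF f]]) (use that in auto)
  have A_iff: "0 + (1 - v) * x \<in> {0<..<(1 - v) * L} \<longleftrightarrow> x \<in> {0<..<L}"
    and B_iff: "0 + - (1 + v) * x \<in> {- (1 + v) * L<..<0} \<longleftrightarrow> x \<in> {0<..<L}" for x
    using v by (auto simp: zero_less_mult_iff mult_less_0_iff)
  have sA: "{0<..<(1 - v) * L} \<subseteq> {- 2 * L<..<2 * L}" and sB: "{- (1 + v) * L<..<0} \<subseteq> {- 2 * L<..<2 * L}"
  proof -
    show "{- (1 + v) * L<..<0} \<subseteq> {- 2 * L<..<2 * L}"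
      unfolding greaterThanLessThan_subseteq_greaterThanLessThan using L vL'(1) by linarith
    show "{0<..<(1 - v) * L} \<subseteq> {- 2 * L<..<2 * L}"
      unfolding greaterThanLessThan_subseteq_greaterThanLessThan using L vL(2) by linarith
  qed
  have A: "integrable ?M (\<lambda>x. (f ((1 - v) * x))\<^sup>2)"
    "(\<integral>x. (f ((1 - v) * x))\<^sup>2 \<partial>?M) = (\<integral>y. (f y)\<^sup>2 \<partial>lebesgue_on {0<..<(1 - v) * L}) / (1 - v)"
    "(\<lambda>x. f ((1 - v) * x)) \<in> borel_measurable ?M"
    using lebesgue_on_affine(1,2)[OF _ _ _ A_iff, of "\<lambda>y. (f y)\<^sup>2"] lebesgue_on_affine(3)[OF _ _ _ A_iff, of f]
      fi[of 0 "(1 - v) * L"] vL v L measurable_restrict_mono[OF L2_measurable[OF f] sA] by auto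
  have B: "integrable ?M (\<lambda>x. (f (- ((1 + v) * x)))\<^sup>2)"
    "(\<integral>x. (f (- ((1 + v) * x)))\<^sup>2 \<partial>?M) = (\<integral>y. (f y)\<^sup>2 \<partial>lebesgue_on {- (1 + v) * L<..<0}) / (1 + v)"
    "(\<lambda>x. f (- ((1 + v) * x))) \<in> borel_measurable ?M"
    using lebesgue_on_affine(1,2)[OF _ _ _ B_iff, of "\<lambda>y. (f y)\<^sup>2"] lebesgue_on_affine(3)[OF _ _ _ B_iff, of f]
      fi[of "- (1 + v) * L" 0] vL v L measurable_restrict_mono[OF L2_measurable[OF f] sB]
    unfolding add_0 mult_minus_left by auto
  note [measurable] = A(3) B(3) L2_measurable[OF mx] L2_measurable[OF mt]
  have "energy L v \<phi>x \<phi>t 0 = 1 / 2 * (\<integral>x. (\<phi>t x 0 + v * \<phi>x x 0)\<^sup>2 + (1 - v\<^sup>2) * (\<phi>x x 0)\<^sup>2 \<partial>?M)"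
    by (simp add: energy_def)
  also have "(\<integral>x. (\<phi>t x 0 + v * \<phi>x x 0)\<^sup>2 + (1 - v\<^sup>2) * (\<phi>x x 0)\<^sup>2 \<partial>?M) =
      (\<integral>x. 2 * (1 + v) * (1 - v)\<^sup>2 * (f ((1 - v) * x))\<^sup>2 + 2 * (1 - v) * (1 + v)\<^sup>2 * (f (- ((1 + v) * x)))\<^sup>2 \<partial>?M)"
  proof (rule integral_cong_AE)
    have alg: "(a - b + v * (a + b))\<^sup>2 + (1 - v\<^sup>2) * (a + b)\<^sup>2 = 2 * (1 + v) * a\<^sup>2 + 2 * (1 - v) * b\<^sup>2" for a b :: real
      by (simp add: power2_eq_square algebra_simps)
    show "AE x in ?M. (\<phi>t x 0 + v * \<phi>x x 0)\<^sup>2 + (1 - v\<^sup>2) * (\<phi>x x 0)\<^sup>2 =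
      2 * (1 + v) * (1 - v)\<^sup>2 * (f ((1 - v) * x))\<^sup>2 + 2 * (1 - v) * (1 + v)\<^sup>2 * (f (- ((1 + v) * x)))\<^sup>2"
      using x t by eventually_elim (simp only: alg power_mult_distrib mult.assoc)
  qed measurable
  also have "\<dots> = 2 * (1 + v) * (1 - v)\<^sup>2 * (\<integral>x. (f ((1 - v) * x))\<^sup>2 \<partial>?M) +
      2 * (1 - v) * (1 + v)\<^sup>2 * (\<integral>x. (f (- ((1 + v) * x)))\<^sup>2 \<partial>?M)"
    using A(1) B(1) by simp
  also have "1 / 2 * \<dots> = (1 - v\<^sup>2) * ((\<integral>y. (f y)\<^sup>2 \<partial>lebesgue_on {- (1 + v) * L<..<0}) +
      (\<integral>y. (f y)\<^sup>2 \<partial>lebesgue_on {0<..<(1 - v) * L}))"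
  proof -
    have alg: "1 / 2 * (2 * (1 + v) * (1 - v)\<^sup>2 * (p / (1 - v)) + 2 * (1 - v) * (1 + v)\<^sup>2 * (q / (1 + v))) = (1 - v\<^sup>2) * (q + p)"
      for p q :: real
    proof -
      have *: "2 * (1 + v) * (1 - v)\<^sup>2 * (p / (1 - v)) = 2 * (1 + v) * ((1 - v) * p)"
        "2 * (1 - v) * (1 + v)\<^sup>2 * (q / (1 + v)) = 2 * (1 - v) * ((1 + v) * q)"
        using v by (simp_all add: power2_eq_square)
      show ?thesis unfolding * by (simp add: power2_eq_square algebra_simps)
    qed
    show ?thesis unfolding A(2) B(2) alg ..
  qed
  also have "\<dots> = (1 - v\<^sup>2) * (\<integral>y. (f y)\<^sup>2 \<partial>lebesgue_on {- (1 + v) * L<..<(1 - v) * L})"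
    by (simp only: integral_lebesgue_on_split[OF fi[OF vL'(1) vL(2)] vL'(2) less_imp_le[OF vL(4)]])
  finally show ?thesis .
qed

text \<open>For the continuous periodic \<open>r N\<close> this is a substitution and the invariance of the integral over a
  period; both sides pass to the \<open>L\<^sup>2\<close> limit. Working with \<open>r N\<close> avoids having to state that \<open>f\<close> is
  periodic almost everywhere.\<close>
lemma trace_norm_eq_profile_norm:
  assumes L: "0 < L" and v: "0 < v" "v < 1" and s: "0 \<le> s"
    and r: "\<And>N. continuous_on UNIV (r N)" and per: "\<And>N y. r N (y + 2 * L) = r N y"
    and f: "f \<in> L2 (- 2 * L) (2 * L)" and rf: "(\<lambda>N. L2_norm (- 2 * L) (2 * L) (\<lambda>y. r N y - f y)) \<longlonglongrightarrow> 0"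
    and g: "g \<in> L2 0 (real M * T_period L v)"
    and rg: "(\<lambda>N. L2_norm 0 (real M * T_period L v) (\<lambda>t. 2 * r N ((1 - v\<^sup>2) * t + s) - g t)) \<longlonglongrightarrow> 0"
  shows "(\<integral>t. (g t)\<^sup>2 \<partial>lebesgue_on {0..real M * T_period L v}) =
      4 * real M / (1 - v\<^sup>2) * (\<integral>y. (f y)\<^sup>2 \<partial>lebesgue_on {- (1 + v) * L<..<(1 - v) * L})"
proof -
  define T where "T = real M * T_period L v"
  define a b where "a = - (1 + v) * L" and "b = (1 - v) * L"
  have v2: "0 < 1 - v\<^sup>2" using v by (rule one_minus_square_pos)
  have T: "(1 - v\<^sup>2) * T = real M * (2 * L)" using v2 by (simp add: T_def T_period_def)
  have ab: "a + 2 * L = b" "a \<le> 0" using v L by (simp_all add: a_def b_def mult_le_0_iff algebra_simps del: minus_add_distrib)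
  have sub: "{a<..<b} \<subseteq> {- 2 * L<..<2 * L}"
  proof -
    have "(1 + v) * L \<le> 2 * L" "(1 - v) * L \<le> 2 * L" using v L by (auto intro!: mult_right_mono)
    moreover from this(1) have "- 2 * L \<le> - (1 + v) * L" by (simp add: algebra_simps)
    ultimately show ?thesis
      unfolding a_def b_def greaterThanLessThan_subseteq_greaterThanLessThan by blast
  qed
  have rL: "r N \<in> L2 p q" for N p q by (intro continuous_L2) (meson r continuous_on_subset subset_UNIV)
  have Rc: "continuous_on S (\<lambda>t. 2 * r N ((1 - v\<^sup>2) * t + s))" for N S
    by (intro continuous_intros continuous_on_compose2[OF r[of N]]) auto
  have eq: "(L2_norm 0 T (\<lambda>t. 2 * r N ((1 - v\<^sup>2) * t + s)))\<^sup>2 = 4 * real M / (1 - v\<^sup>2) * (L2_norm a b (r N))\<^sup>2" for N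
  proof -
    have iff: "s + (1 - v\<^sup>2) * t \<in> {s<..<s + real M * (2 * L)} \<longleftrightarrow> t \<in> {0<..<T}" for t
      unfolding T[symmetric] using v2 by (auto simp: zero_less_mult_iff)
    have "(L2_norm 0 T (\<lambda>t. 2 * r N ((1 - v\<^sup>2) * t + s)))\<^sup>2 = 4 * (\<integral>t. (r N (s + (1 - v\<^sup>2) * t))\<^sup>2 \<partial>lebesgue_on {0<..<T})"
      unfolding L2_norm_square by (simp add: power_mult_distrib add.commute)
    also have "\<dots> = 4 / (1 - v\<^sup>2) * (\<integral>y. (r N y)\<^sup>2 \<partial>lebesgue_on {s<..<s + real M * (2 * L)})"
      using lebesgue_on_affine(2)[OF _ _ _ iff, of "\<lambda>y. (r N y)\<^sup>2"] v2 by simp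
    also have "(\<integral>y. (r N y)\<^sup>2 \<partial>lebesgue_on {s<..<s + real M * (2 * L)}) =
        real M * (\<integral>y. (r N y)\<^sup>2 \<partial>lebesgue_on {a<..<a + 2 * L})"
      by (rule integral_periodic) (use r per L ab s in \<open>auto intro!: continuous_intros\<close>)
    finally show ?thesis by (simp add: L2_norm_square ab)
  qed
  have "(\<lambda>N. (L2_norm 0 T (\<lambda>t. 2 * r N ((1 - v\<^sup>2) * t + s)))\<^sup>2) \<longlonglongrightarrow> (L2_norm 0 T g)\<^sup>2"
    using g rg unfolding T_def[symmetric] by (intro tendsto_power L2_norm_tendsto continuous_L2[OF Rc])
  moreover have "(\<lambda>N. 4 * real M / (1 - v\<^sup>2) * (L2_norm a b (r N))\<^sup>2) \<longlonglongrightarrow> 4 * real M / (1 - v\<^sup>2) * (L2_norm a b f)\<^sup>2"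
  proof (intro tendsto_mult_left tendsto_power L2_norm_tendsto rL L2_subset[OF f sub])
    show "(\<lambda>N. L2_norm a b (\<lambda>x. r N x - f x)) \<longlonglongrightarrow> 0"
      by (rule Lim_null_comparison[OF always_eventually rf])
        (use L2_norm_subset_mono[OF L2_diff[OF rL f] sub] in simp)
  qed
  ultimately have "(L2_norm 0 T g)\<^sup>2 = 4 * real M / (1 - v\<^sup>2) * (L2_norm a b f)\<^sup>2"
    unfolding eq by (rule LIMSEQ_unique)
  then show ?thesis
    by (simp add: L2_norm_square integral_lebesgue_on_Ioo T_def a_def b_def)
qed

lemma trace_energy_identity:
  assumes L: "0 < L" and v: "0 < v" "v < 1" and xb: "xb = 0 \<or> xb = L"
    and sol: "weak_solution L v \<phi>0 \<phi>1 \<phi> \<phi>x \<phi>t" and trace: "endpoint_trace L v xb \<phi> g" and M: "1 \<le> M"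
  shows "(\<integral>t. (g t)\<^sup>2 \<partial>lebesgue_on {0..real M * T_period L v}) =
      4 * real M / (1 - v\<^sup>2)\<^sup>2 * energy L v \<phi>x \<phi>t 0"
proof -
  obtain U r f where prof: "wave_profile L v \<phi> U r f"
    and g: "\<And>T. 0 < T \<Longrightarrow> g \<in> L2 0 T"
    and rg: "\<And>T. 0 < T \<Longrightarrow> (\<lambda>N. L2_norm 0 T (\<lambda>t. 2 * r N ((1 - v\<^sup>2) * t + (1 - v) * xb) - g t)) \<longlonglongrightarrow> 0"
    by (rule endpoint_trace_imp_profile[OF L v xb trace]) blast
  have v2: "0 < 1 - v\<^sup>2" using v by (rule one_minus_square_pos)
  have T: "0 < real M * T_period L v" using M L v2 by (simp add: T_period_def)
  have s: "0 \<le> (1 - v) * xb" using xb L v by auto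
  have r: "\<And>N. continuous_on UNIV (r N)" and per: "\<And>N y. r N (y + 2 * L) = r N y"
    and f: "f \<in> L2 (- 2 * L) (2 * L)" and rf: "(\<lambda>N. L2_norm (- 2 * L) (2 * L) (\<lambda>y. r N y - f y)) \<longlonglongrightarrow> 0"
    using prof unfolding wave_profile_def by auto
  have "C_H10 L v L \<phi> \<phi>x" "C_L2 L v L \<phi>t" using sol L by (auto simp: weak_solution_def)
  then have "(\<lambda>x. \<phi>x x 0) \<in> L2 0 L" "(\<lambda>x. \<phi>t x 0) \<in> L2 0 L"
    using L by (force simp: C_H10_def C_L2_def)+
  then have E: "energy L v \<phi>x \<phi>t 0 = (1 - v\<^sup>2) * (\<integral>y. (f y)\<^sup>2 \<partial>lebesgue_on {- (1 + v) * L<..<(1 - v) * L})"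
    by (rule energy_eq_profile_norm[where \<phi>x = \<phi>x and \<phi>t = \<phi>t, OF L v f _ _ weak_solution_initial_derivatives[OF L v sol prof]])
  show ?thesis
    unfolding trace_norm_eq_profile_norm[OF L v s r per f rf g[OF T] rg[OF T]] E
    using v2 by (simp add: power2_eq_square)
qed

lemma trace_integral_mono:
  assumes trace: "endpoint_trace L v xb \<phi> g" and T: "S \<le> T"
  shows "(\<integral>t. (g t)\<^sup>2 \<partial>lebesgue_on {0..S}) \<le> (\<integral>t. (g t)\<^sup>2 \<partial>lebesgue_on {0..T})"
proof -
  have "g \<in> L2 0 (max 1 T)" using trace unfolding endpoint_trace_def by (metis less_max_iff_disj zero_less_one)
  then have "integrable (lebesgue_on {0<..<max 1 T}) (\<lambda>t. (g t)\<^sup>2)" by (rule L2_integrable_square)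
  then have "integrable (lebesgue_on {0..T}) (\<lambda>t. (g t)\<^sup>2)"
    unfolding integrable_lebesgue_on_Ioo_iff by (rule integrable_lebesgue_on_subset) auto
  then show ?thesis by (rule integral_lebesgue_on_subset_mono) (use T in auto)
qed

text \<open>The interval \<open>[0,T]\<close> is covered by finitely many multiples of \<open>T\<^sub>v\<close>, for which the identity is exact.
  The successor keeps the multiple positive when \<open>T = 0\<close>.\<close>
lemma direct_inequality:
  assumes L: "0 < L" and v: "0 < v" "v < 1" and xb: "xb = 0 \<or> xb = L"
    and sol: "weak_solution L v \<phi>0 \<phi>1 \<phi> \<phi>x \<phi>t" and trace: "endpoint_trace L v xb \<phi> g"
  shows "(\<integral>t. (g t)\<^sup>2 \<partial>lebesgue_on {0..T}) \<le>
     4 * real (Suc (nat \<lceil>T / T_period L v\<rceil>)) / (1 - v\<^sup>2)\<^sup>2 * energy L v \<phi>x \<phi>t 0"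
proof -
  let ?M = "Suc (nat \<lceil>T / T_period L v\<rceil>)"
  have "0 < 1 - v\<^sup>2" using v by (rule one_minus_square_pos)
  then have Tv: "0 < T_period L v" using L by (simp add: T_period_def)
  have "T / T_period L v \<le> real ?M" by linarith
  then have "T \<le> real ?M * T_period L v" using Tv by (simp add: divide_le_eq)
  from trace_integral_mono[OF trace this] show ?thesis
    using trace_energy_identity[OF L v xb sol trace, of ?M] by simp
qed

lemma inverse_inequality:
  assumes L: "0 < L" and v: "0 < v" "v < 1" and xb: "xb = 0 \<or> xb = L"
    and sol: "weak_solution L v \<phi>0 \<phi>1 \<phi> \<phi>x \<phi>t" and trace: "endpoint_trace L v xb \<phi> g" 
    and T: "T_period L v \<le> T"
  shows "energy L v \<phi>x \<phi>t 0 \<le> (1 - v\<^sup>2)\<^sup>2 / 4 * (\<integral>t. (g t)\<^sup>2 \<partial>lebesgue_on {0..T})"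
proof -
  have v2: "0 < 1 - v\<^sup>2" using v by (rule one_minus_square_pos)
  have "energy L v \<phi>x \<phi>t 0 = (1 - v\<^sup>2)\<^sup>2 / 4 * (\<integral>t. (g t)\<^sup>2 \<partial>lebesgue_on {0..T_period L v})"
    using trace_energy_identity[OF L v xb sol trace, of 1] v2 by (simp add: field_simps)
  also have "\<dots> \<le> (1 - v\<^sup>2)\<^sup>2 / 4 * (\<integral>t. (g t)\<^sup>2 \<partial>lebesgue_on {0..T})"
    by (intro mult_left_mono trace_integral_mono[OF trace T]) simp
  finally show ?thesis .
qed

section \<open>The observability theorem\<close>

theorem theorem3:
  fixes L :: real
  assumes "L > 0"
  shows
   "(\<forall>v xb. 0 < v \<and> v < 1 \<and> (xb = 0 \<or> xb = L) \<longrightarrow>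
       (\<forall>\<phi>0\<in>H10 0 L. \<forall>\<phi>1\<in>L2 0 L. \<forall>\<phi> \<phi>x \<phi>t g.
          weak_solution L v \<phi>0 \<phi>1 \<phi> \<phi>x \<phi>t \<and> endpoint_trace L v xb \<phi> g \<longrightarrow>
          (\<forall>M::nat. M \<ge> 1 \<longrightarrow>
             (\<integral>t. (g t)\<^sup>2 \<partial>lebesgue_on {0..real M * T_period L v}) =
             4 * real M / (1 - v\<^sup>2)\<^sup>2 * energy L v \<phi>x \<phi>t 0))) \<and>
    (\<exists>K1 :: real \<Rightarrow> real \<Rightarrow> real. \<forall>v xb. 0 < v \<and> v < 1 \<and> (xb = 0 \<or> xb = L) \<longrightarrow>
       (\<forall>\<phi>0\<in>H10 0 L. \<forall>\<phi>1\<in>L2 0 L. \<forall>\<phi> \<phi>x \<phi>t g.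
          weak_solution L v \<phi>0 \<phi>1 \<phi> \<phi>x \<phi>t \<and> endpoint_trace L v xb \<phi> g \<longrightarrow>
          (\<forall>T\<ge>0. (\<integral>t. (g t)\<^sup>2 \<partial>lebesgue_on {0..T}) \<le> K1 v T * energy L v \<phi>x \<phi>t 0))) \<and>
    (\<forall>v xb T. 0 < v \<and> v < 1 \<and> (xb = 0 \<or> xb = L) \<and> T \<ge> T_period L v \<longrightarrow>
       observable L v xb T \<and>
       (\<forall>\<phi>0\<in>H10 0 L. \<forall>\<phi>1\<in>L2 0 L. \<forall>\<phi> \<phi>x \<phi>t g.
          weak_solution L v \<phi>0 \<phi>1 \<phi> \<phi>x \<phi>t \<and> endpoint_trace L v xb \<phi> g \<longrightarrow>
          energy L v \<phi>x \<phi>t 0 \<le> (1 - v\<^sup>2)\<^sup>2 / 4 * (\<integral>t. (g t)\<^sup>2 \<partial>lebesgue_on {0..T})))"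
proof (intro conjI)
  show "\<forall>v xb. 0 < v \<and> v < 1 \<and> (xb = 0 \<or> xb = L) \<longrightarrow>
       (\<forall>\<phi>0\<in>H10 0 L. \<forall>\<phi>1\<in>L2 0 L. \<forall>\<phi> \<phi>x \<phi>t g.
          weak_solution L v \<phi>0 \<phi>1 \<phi> \<phi>x \<phi>t \<and> endpoint_trace L v xb \<phi> g \<longrightarrow>
          (\<forall>M::nat. M \<ge> 1 \<longrightarrow>
             (\<integral>t. (g t)\<^sup>2 \<partial>lebesgue_on {0..real M * T_period L v}) =
             4 * real M / (1 - v\<^sup>2)\<^sup>2 * energy L v \<phi>x \<phi>t 0))"
    using trace_energy_identity[OF assms] by blast
  show "\<exists>K1 :: real \<Rightarrow> real \<Rightarrow> real. \<forall>v xb. 0 < v \<and> v < 1 \<and> (xb = 0 \<or> xb = L) \<longrightarrow>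
       (\<forall>\<phi>0\<in>H10 0 L. \<forall>\<phi>1\<in>L2 0 L. \<forall>\<phi> \<phi>x \<phi>t g.
          weak_solution L v \<phi>0 \<phi>1 \<phi> \<phi>x \<phi>t \<and> endpoint_trace L v xb \<phi> g \<longrightarrow>
          (\<forall>T\<ge>0. (\<integral>t. (g t)\<^sup>2 \<partial>lebesgue_on {0..T}) \<le> K1 v T * energy L v \<phi>x \<phi>t 0))"
    by (rule exI[of _ "\<lambda>v T. 4 * real (Suc (nat \<lceil>T / T_period L v\<rceil>)) / (1 - v\<^sup>2)\<^sup>2"])
      (use direct_inequality[OF assms] in blast)
  show "\<forall>v xb T. 0 < v \<and> v < 1 \<and> (xb = 0 \<or> xb = L) \<and> T \<ge> T_period L v \<longrightarrow>
       observable L v xb T \<and>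
       (\<forall>\<phi>0\<in>H10 0 L. \<forall>\<phi>1\<in>L2 0 L. \<forall>\<phi> \<phi>x \<phi>t g.
          weak_solution L v \<phi>0 \<phi>1 \<phi> \<phi>x \<phi>t \<and> endpoint_trace L v xb \<phi> g \<longrightarrow>
          energy L v \<phi>x \<phi>t 0 \<le> (1 - v\<^sup>2)\<^sup>2 / 4 * (\<integral>t. (g t)\<^sup>2 \<partial>lebesgue_on {0..T}))"
  proof (intro allI impI conjI)
    fix v xb T assume h: "0 < v \<and> v < 1 \<and> (xb = 0 \<or> xb = L) \<and> T \<ge> T_period L v"
    then have "v\<^sup>2 \<noteq> 1" by (auto simp: power2_eq_1_iff)
    then have "0 < (1 - v\<^sup>2)\<^sup>2 / 4" by simp
    then show "observable L v xb T"
      unfolding observable_def using inverse_inequality[OF assms] h by blast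
  qed (use inverse_inequality[OF assms] in blast)
qed

end
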